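(* For every integer $n \ge 3$ and every integer $i$ with $0 \leq i \leq (n-2)!$, there exists a shortened universal cycle for $S_n$, using incomparable elements at distance $n-1$, of length $n!-i(n-1)$.
   Context: $S_n$ denotes the set of all permutations of $[n]=\{1,\dots,n\}$, written in one-line notation $\pi=\pi_1\pi_2\cdots\pi_n$. A cyclic word of length $N$ is a sequence $z_1z_2\cdots z_N$ of letters from $\mathbb{N}$ with indices read modulo $N$. Letters are not restricted to $[n]$ and any number of distinct letters may be used. Its $n$-windows are the $N$ words $z_jz_{j+1}\cdots z_{j+n-1}$, $1\le j\le N$ (indices modulo $N$). Equal letters inside an $n$-window are regarded as incomparable: a word $u=u_1\cdots u_n$ of length $n$ covers a permutation $\pi\in S_n$ if $\pi$ is a linear extension of the order given by $u$, i.e. for all $a,b\in[n]$, $u_a<u_b$ implies $\pi_a<\pi_b$. Thus a word with distinct letters covers exactly the one permutation order-isomorphic to it. A word $u$ with $u_1=u_n$ and no other equalities among its letters covers exactly two permutations; for example $2132$ covers $2143$ and $3142$. A shortened universal cycle for $S_n$ using incomparable elements at distance $n-1$ is a cyclic word such that: (1) in every $n$-window, the only two letters that may be equal are the first and the last (equal letters within a window are at distance exactly $n-1$); and (2) every permutation in $S_n$ is covered by exactly one $n$-window (i.e. by the window starting at exactly one position $j$). The case with no equal letters within any window (length $n!$) is an ordinary universal cycle for $S_n$ and is included. *)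

theory Defs
  imports "HOL-Combinatorics.Multiset_Permutations"
begin

text \<open>
  A cyclic word of length \<open>N\<close> is represented by any of its \<open>N\<close> linearizations, a list of length
  \<open>N\<close>. Positions are counted from \<open>0\<close>. A permutation of \<open>{1..n}\<close> in one-line notation is an
  element of \<^term>\<open>permutations_of_set {1..n}\<close>.
\<close>

definition cyclic_window :: "nat \<Rightarrow> 'a list \<Rightarrow> nat \<Rightarrow> 'a list" where
  "cyclic_window n z j = map (\<lambda>k. z ! ((j + k) mod length z)) [0..<n]"

definition covers :: "nat list \<Rightarrow> nat list \<Rightarrow> bool" where
  "covers u p \<longleftrightarrow> length u = length p \<and>
     (\<forall>a<length u. \<forall>b<length u. u ! a < u ! b \<longrightarrow> p ! a < p ! b)"

text \<open>
  Covering is counted by starting position, so two positions carrying the same window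
  count separately.
\<close>

definition shortened_ucycle :: "nat \<Rightarrow> nat list \<Rightarrow> bool" where
  "shortened_ucycle n z \<longleftrightarrow>
     (\<forall>j<length z. \<forall>a b. a < b \<and> b < n \<and> cyclic_window n z j ! a = cyclic_window n z j ! b
        \<longrightarrow> a = 0 \<and> b = n - 1) \<and>
     (\<forall>p\<in>permutations_of_set {1..n}. \<exists>!j. j < length z \<and> covers (cyclic_window n z j) p)"

end

theory Submission
  imports Defs "Graph_Theory.Euler"
begin

text \<open>
  Put \<open>m = n - 1\<close>. The patterns of \<open>m\<close> consecutive letters are the permutations of \<open>{1..m}\<close>, and a
  window of length \<open>n\<close> is an arc from the pattern of its first \<open>m\<close> letters to the pattern of its
  last \<open>m\<close> letters. Every vertex of this graph has \<open>n\<close> outgoing and \<open>n\<close> incoming arcs. Two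
  permutations can be covered by one window with equal ends exactly when they differ only by
  exchanging the adjacent values at their two ends; these are two parallel arcs from some \<open>\<sigma>\<close> to
  its rotation, and they may be replaced by the single arc \<open>merged \<sigma>\<close>. Merging along all \<open>m\<close> rotations
  of \<open>\<sigma>\<close> removes a directed cycle of \<open>m\<close> arcs and so keeps the graph balanced. There are
  \<open>(n - 2)!\<close> such rotation classes; merging in \<open>i\<close> of them leaves \<open>n! - i (n - 1)\<close> arcs, and each
  permutation of \<open>{1..n}\<close> is covered by exactly one of them (\<open>window_arcs_cover_uniquely\<close>,
  \<open>card_window_arcs\<close>).

  An Eulerian circuit lists the windows in a consistent order, and a linear word with these windows
  always exists over a dense order (\<open>cas_imp_realizes\<close>). The difficulty is to close this word up:
  after a full turn, the letters have to be the initial ones and not merely order isomorphic to them.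
  For this the circuit is made to contain a trail along which all letters of the window are first
  replaced by \<open>m\<close> letters that only have to be larger than everything before them, and then again by
  \<open>m\<close> letters that only have to be smaller. If the large block is chosen above every letter of the
  remaining word, then the word with this block in front of it, read cyclically, has
  the windows of the circuit (\<open>reset_closes_word\<close>).

  The block sequence is \<open>1 2 \<dots> m\<close>, then \<open>2 1 3 \<dots> m\<close> shifted up, then \<open>m \<dots> 2 1\<close>. The
  position of the letter \<open>1\<close> in the middle block makes each window of the trail contain an inner
  letter strictly between its two ends, so that no window of the trail is ever merged and all rotation
  arcs remain outside the trail. The graph without the trail is still connected: the rotations
  together with the arcs that exchange two adjacent values \<open>a\<close> and \<open>a + 1\<close> generate all permutations
  (\<open>linked_perms\<close>). Hence Euler's theorem for open trails supplies the rest of the circuit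
  (\<open>euler_trail_avoiding\<close>).

  The trail needs \<open>m \<ge> 3\<close>; for permutations of three letters, explicit words are given.
\<close>

section \<open>Order isomorphism of words\<close>

definition order_iso :: "'a::linorder list \<Rightarrow> 'b::linorder list \<Rightarrow> bool" where
  "order_iso u v \<longleftrightarrow> length u = length v \<and>
     (\<forall>a<length u. \<forall>b<length u. u ! a < u ! b \<longleftrightarrow> v ! a < v ! b)"

lemma order_iso_sym: "order_iso u v \<Longrightarrow> order_iso v u"
  by (simp add: order_iso_def)

lemma order_iso_trans [trans]: "order_iso u v \<Longrightarrow> order_iso v w \<Longrightarrow> order_iso u w"
  by (simp add: order_iso_def)

lemma order_iso_length: "order_iso u v \<Longrightarrow> length u = length v"
  by (simp add: order_iso_def)

lemma order_iso_less:
  "order_iso u v \<Longrightarrow> a < length v \<Longrightarrow> b < length v \<Longrightarrow> u ! a < u ! b \<longleftrightarrow> v ! a < v ! b"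
  by (simp add: order_iso_def)

lemma order_iso_eq:
  "order_iso u v \<Longrightarrow> a < length v \<Longrightarrow> b < length v \<Longrightarrow> u ! a = u ! b \<longleftrightarrow> v ! a = v ! b"
  using order_iso_less[of u v a b] order_iso_less[of u v b a] by (metis neq_iff)

lemma order_iso_take: "order_iso u v \<Longrightarrow> order_iso (take k u) (take k v)"
  by (simp add: order_iso_def)

lemma order_iso_drop: "order_iso u v \<Longrightarrow> order_iso (drop k u) (drop k v)"
  by (simp add: order_iso_def)

lemma order_iso_butlast: "order_iso u v \<Longrightarrow> order_iso (butlast u) (butlast v)"
  by (simp add: butlast_conv_take order_iso_length order_iso_take)

lemma order_iso_tl: "order_iso u v \<Longrightarrow> order_iso (tl u) (tl v)"
  using order_iso_drop[of u v 1] by (simp add: drop_Suc)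

lemma order_iso_rev: "order_iso u v \<Longrightarrow> order_iso (rev u) (rev v)"
  by (auto simp: order_iso_def rev_nth)

lemma order_iso_distinct: "order_iso u v \<Longrightarrow> distinct u \<longleftrightarrow> distinct v"
  by (auto simp: distinct_conv_nth order_iso_eq order_iso_length)

lemma order_iso_map:
  assumes "\<And>x y. x \<in> set u \<Longrightarrow> y \<in> set u \<Longrightarrow> f x < f y \<longleftrightarrow> x < y"
  shows "order_iso (map f u) u"
  using assms by (simp add: order_iso_def)

lemma order_iso_append_less:
  assumes "order_iso u u'" and "order_iso v v'"
    and "\<And>x y. x \<in> set u \<Longrightarrow> y \<in> set v \<Longrightarrow> x < y"
    and "\<And>x y. x \<in> set u' \<Longrightarrow> y \<in> set v' \<Longrightarrow> x < y"
  shows "order_iso (u @ v) (u' @ v')"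
proof -
  have len: "length u = length u'" "length v = length v'"
    using assms by (simp_all add: order_iso_length)
  have "(u @ v) ! a < (u @ v) ! b \<longleftrightarrow> (u' @ v') ! a < (u' @ v') ! b"
    if "a < length u + length v" "b < length u + length v" for a b
  proof -
    have 1: "u ! i < v ! j" "u' ! i < v' ! j" "\<not> v ! j < u ! i" "\<not> v' ! j < u' ! i"
      if "i < length u'" "j < length v'" for i j
      using assms(3)[of "u ! i" "v ! j"] assms(4)[of "u' ! i" "v' ! j"] that len
      by (simp_all add: less_imp_not_less)
    have 2: "a \<ge> length u' \<Longrightarrow> a - length u' < length v'" "b \<ge> length u' \<Longrightarrow> b - length u' < length v'"
      using that len by auto
    show ?thesis
      using 2 1[of a "b - length u'"] 1[of b "a - length u'"] len
        order_iso_less[OF assms(1), of a b]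
        order_iso_less[OF assms(2), of "a - length u'" "b - length u'"]
      by (cases "a < length u'"; cases "b < length u'")
        (simp_all add: nth_append)
  qed
  then show ?thesis using len by (simp add: order_iso_def)
qed

lemma order_iso_append_greater:
  assumes "order_iso u u'" and "order_iso v v'"
    and "\<And>x y. x \<in> set u \<Longrightarrow> y \<in> set v \<Longrightarrow> y < x"
    and "\<And>x y. x \<in> set u' \<Longrightarrow> y \<in> set v' \<Longrightarrow> y < x"
  shows "order_iso (u @ v) (u' @ v')"
proof -
  have "order_iso (rev v @ rev u) (rev v' @ rev u')"
    using assms by (intro order_iso_append_less order_iso_rev) auto
  from order_iso_rev[OF this] show ?thesis by simp
qed

text \<open>
  The pattern of a word. Counting positions instead of letters makes it an invariant of order
  isomorphism even for words with repeated letters; on distinct letters it is the usual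
  standardization to a permutation.
\<close>

definition std :: "'a::linorder list \<Rightarrow> nat list" where
  "std w = map (\<lambda>a. card {b. b < length w \<and> w ! b \<le> w ! a}) [0..<length w]"

lemma length_std [simp]: "length (std w) = length w"
  by (simp add: std_def)

lemma order_iso_std: "order_iso (std w) w"
proof -
  have "card {c. c < length w \<and> w ! c \<le> w ! a} < card {c. c < length w \<and> w ! c \<le> w ! b} \<longleftrightarrow> w ! a < w ! b"
    if "a < length w" "b < length w" for a b
  proof
    assume "w ! a < w ! b"
    moreover from this have "b \<notin> {c. c < length w \<and> w ! c \<le> w ! a}" by (simp add: not_le)
    ultimately have "{c. c < length w \<and> w ! c \<le> w ! a} \<subset> {c. c < length w \<and> w ! c \<le> w ! b}"
      using that by auto
    then show "card {c. c < length w \<and> w ! c \<le> w ! a} < card {c. c < length w \<and> w ! c \<le> w ! b}"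
      by (intro psubset_card_mono) auto
  next
    assume *: "card {c. c < length w \<and> w ! c \<le> w ! a} < card {c. c < length w \<and> w ! c \<le> w ! b}"
    show "w ! a < w ! b"
    proof (rule ccontr)
      assume "\<not> w ! a < w ! b"
      then have "{c. c < length w \<and> w ! c \<le> w ! b} \<subseteq> {c. c < length w \<and> w ! c \<le> w ! a}"
        by auto
      then have "card {c. c < length w \<and> w ! c \<le> w ! b} \<le> card {c. c < length w \<and> w ! c \<le> w ! a}"
        by (intro card_mono) auto
      with * show False by simp
    qed
  qed
  then show ?thesis by (simp add: order_iso_def std_def)
qed

lemma std_cong: "order_iso u v \<Longrightarrow> std u = std v"
proof -
  assume iso: "order_iso u v"
  then have "u ! b \<le> u ! a \<longleftrightarrow> v ! b \<le> v ! a" if "a < length v" "b < length v" for a b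
    using order_iso_less[OF iso that] by (simp add: not_less[symmetric])
  then have "{b. b < length v \<and> u ! b \<le> u ! a} = {b. b < length v \<and> v ! b \<le> v ! a}"
    if "a < length v" for a using that by auto
  then show "std u = std v" using order_iso_length[OF iso] by (simp add: std_def)
qed

definition perms :: "nat \<Rightarrow> nat list set" where
  "perms m = permutations_of_set {1..m}"

lemma perms_iff: "\<sigma> \<in> perms m \<longleftrightarrow> set \<sigma> = {1..m} \<and> distinct \<sigma>"
  by (auto simp: perms_def permutations_of_set_def)

lemma length_perms: "\<sigma> \<in> perms m \<Longrightarrow> length \<sigma> = m"
  using length_finite_permutations_of_set by (fastforce simp: perms_def)

lemma std_perms: "\<sigma> \<in> perms m \<Longrightarrow> std \<sigma> = \<sigma>"
proof (rule nth_equalityI)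
  fix a assume s: "\<sigma> \<in> perms m" and "a < length (std \<sigma>)"
  then have a: "a < length \<sigma>" by simp
  have inj: "inj_on ((!) \<sigma>) {b. b < length \<sigma> \<and> \<sigma> ! b \<le> \<sigma> ! a}"
    using s by (auto simp: perms_iff inj_on_def nth_eq_iff_index_eq)
  have "(!) \<sigma> ` {b. b < length \<sigma> \<and> \<sigma> ! b \<le> \<sigma> ! a} = {y \<in> set \<sigma>. y \<le> \<sigma> ! a}"
    by (auto simp: in_set_conv_nth)
  also have "\<dots> = {1..\<sigma> ! a}"
    using s a nth_mem[OF a] by (auto simp: perms_iff)
  finally have "card {b. b < length \<sigma> \<and> \<sigma> ! b \<le> \<sigma> ! a} = \<sigma> ! a"
    using card_image[OF inj] by simp
  then show "std \<sigma> ! a = \<sigma> ! a" using a by (simp add: std_def)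
qed simp

lemma std_in_perms: "distinct w \<Longrightarrow> std w \<in> perms (length w)"
proof -
  assume "distinct w"
  then have d: "distinct (std w)" using order_iso_distinct[OF order_iso_std] by blast
  have "set (std w) \<subseteq> {1..length w}"
  proof
    fix y assume "y \<in> set (std w)"
    then obtain a where a: "a < length w" "y = card {b. b < length w \<and> w ! b \<le> w ! a}"
      by (auto simp: std_def)
    have "card {b. b < length w \<and> w ! b \<le> w ! a} \<le> card {..<length w}"
      by (intro card_mono) auto
    moreover have "card {b. b < length w \<and> w ! b \<le> w ! a} > 0"
      using a by (auto simp: card_gt_0_iff)
    ultimately show "y \<in> {1..length w}" using a by simp
  qed
  moreover have "card (set (std w)) = card {1..length w}"
    using d by (simp add: distinct_card)
  ultimately show ?thesis using d by (simp add: perms_iff card_subset_eq)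
qed

lemma std_eq_perm: "order_iso w \<sigma> \<Longrightarrow> \<sigma> \<in> perms m \<Longrightarrow> std w = \<sigma>"
  using std_cong std_perms by metis

lemma std_rev: "distinct w \<Longrightarrow> std (rev w) = rev (std w)"
  using std_eq_perm[of "rev w" "rev (std w)" "length w"] std_in_perms[of w]
    order_iso_rev[OF order_iso_sym[OF order_iso_std[of w]]] by (simp add: perms_iff)

text \<open>
  After one value \<open>k\<close> has been deleted from a permutation, the larger values move down by one.
  This is how heads and tails of arcs are computed.
\<close>

lemma std_upt_minus:
  assumes "distinct w" and "set w = {1..Suc m} - {k}" and "k \<in> {1..Suc m}"
  shows "std w = map (\<lambda>x. if k < x then x - 1 else x) w"
proof -
  define f where "f x = (if k < x then x - 1 else x)" for x :: nat
  have mono: "f x < f y \<longleftrightarrow> x < y" if "x \<in> set w" "y \<in> set w" for x y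
  proof -
    have "x \<noteq> k" "y \<noteq> k" using that unfolding assms(2) by auto
    then show ?thesis by (cases "k < x"; cases "k < y") (auto simp: f_def)
  qed
  have inj: "inj_on f (set w)"
  proof (rule inj_onI)
    fix x y assume "x \<in> set w" "y \<in> set w" "f x = f y"
    then have "\<not> x < y" "\<not> y < x" using mono[of x y] mono[of y x] by simp_all
    then show "x = y" by simp
  qed
  have "f ` set w \<subseteq> {1..m}"
  proof (rule image_subsetI)
    fix x assume "x \<in> set w"
    then have "1 \<le> x" "x \<le> Suc m" "x \<noteq> k" unfolding assms(2) by auto
    moreover have "1 \<le> k" "k \<le> Suc m" using assms(3) by auto
    ultimately show "f x \<in> {1..m}" by (cases "k < x") (auto simp: f_def)
  qed
  moreover have "card (f ` set w) = card {1..m}"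
    unfolding card_image[OF inj] unfolding assms(2) using assms(3) by simp
  ultimately have "f ` set w = {1..m}" by (simp add: card_subset_eq)
  then have "map f w \<in> perms m" using assms(1) inj by (simp add: perms_iff distinct_map)
  moreover have "order_iso w (map f w)" using order_iso_sym[OF order_iso_map[of w f]] mono by blast
  ultimately show ?thesis using std_eq_perm unfolding f_def by blast
qed

section \<open>Words that trace a sequence of patterns\<close>

definition realizes :: "nat \<Rightarrow> 'a::linorder list \<Rightarrow> 'b::linorder list list \<Rightarrow> bool" where
  "realizes m W es \<longleftrightarrow> length W = length es + m \<and>
     (\<forall>j<length es. order_iso (take (Suc m) (drop j W)) (es ! j))"

lemma realizes_Cons:
  "realizes m W (e # es) \<longleftrightarrow> W \<noteq> [] \<and> order_iso (take (Suc m) W) e \<and> realizes m (tl W) es"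
  by (cases W) (auto simp: realizes_def All_less_Suc2)

text \<open>
  Two words may be glued along a common block of \<open>m\<close> letters, since a window of length \<open>m + 1\<close>
  that starts before this block cannot reach beyond it.
\<close>

lemma realizes_append:
  assumes "realizes m (A @ B) es" and "realizes m (B @ C) fs" and "length B = m"
  shows "realizes m (A @ B @ C) (es @ fs)"
proof -
  have lA: "length A = length es" and lC: "length C = length fs"
    using assms by (simp_all add: realizes_def)
  have "order_iso (take (Suc m) (drop j (A @ B @ C))) ((es @ fs) ! j)" if "j < length es + length fs" for j
  proof (cases "j < length es")
    case True
    then have "Suc m \<le> length (drop j (A @ B))" using assms(3) lA by simp
    moreover have "drop j (A @ B @ C) = drop j (A @ B) @ C" using True lA by simp
    ultimately have "take (Suc m) (drop j (A @ B @ C)) = take (Suc m) (drop j (A @ B))"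
      by (simp only: take_append) simp
    moreover have "order_iso (take (Suc m) (drop j (A @ B))) (es ! j)"
      using True assms(1) unfolding realizes_def by blast
    ultimately have "order_iso (take (Suc m) (drop j (A @ B @ C))) (es ! j)" by (simp only:)
    then show ?thesis using True by (simp only: nth_append if_True)
  next
    case False
    then have "drop j (A @ B @ C) = drop (j - length es) (B @ C)" using lA by simp
    moreover have "j - length es < length fs" using False that by simp
    then have "order_iso (take (Suc m) (drop (j - length es) (B @ C))) (fs ! (j - length es))"
      using assms(2) unfolding realizes_def by blast
    ultimately show ?thesis using False by (simp only: nth_append if_False)
  qed
  then show ?thesis using lA lC assms(3) by (simp add: realizes_def)
qed

lemma realizes_cong:
  assumes "order_iso V W" and "realizes m W es"
  shows "realizes m V es"
  using assms order_iso_trans[OF order_iso_take[OF order_iso_drop[OF assms(1)]]]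
  by (auto simp: realizes_def order_iso_length)

definition patterns :: "nat \<Rightarrow> 'a::linorder list \<Rightarrow> nat list list" where
  "patterns m W = map (\<lambda>j. std (take (Suc m) (drop j W))) [0..<length W - m]"

lemma realizes_patterns: "m \<le> length W \<Longrightarrow> realizes m W (patterns m W)"
  by (simp add: realizes_def patterns_def order_iso_sym[OF order_iso_std])

text \<open>
  The arcs are themselves words of length \<open>m + 1\<close>, so that parallel arcs are kept apart by their
  end letters.
\<close>

definition pattern_graph :: "nat \<Rightarrow> nat list set \<Rightarrow> (nat list, nat list) pre_digraph" where
  "pattern_graph m A = \<lparr>verts = perms m, arcs = A, tail = \<lambda>e. std (butlast e), head = \<lambda>e. std (tl e)\<rparr>"

lemma pattern_graph_sel [simp]:
  "verts (pattern_graph m A) = perms m" "arcs (pattern_graph m A) = A"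
  "tail (pattern_graph m A) e = std (butlast e)" "head (pattern_graph m A) e = std (tl e)"
  by (simp_all add: pattern_graph_def)

lemma realizes_imp_cas:
  "realizes m W es \<Longrightarrow>
    pre_digraph.cas (pattern_graph m A) (std (take m W)) es (std (drop (length es) W))"
proof (induction es arbitrary: W)
  case Nil
  then show ?case by (simp add: pre_digraph.cas.simps realizes_def)
next
  case (Cons e es)
  then have W: "W \<noteq> []" "order_iso (take (Suc m) W) e" "realizes m (tl W) es" and l: "Suc m \<le> length W"
    unfolding realizes_Cons by (auto simp: realizes_def Suc_le_eq simp flip: length_greater_0_conv)
  have "std (butlast e) = std (take m W)"
    using std_cong[OF order_iso_butlast[OF W(2)]] l by (simp add: butlast_take)
  moreover have "std (tl e) = std (take m (tl W))"
    using std_cong[OF order_iso_tl[OF W(2)]] by (cases W) simp_all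
  ultimately show ?case using Cons.IH[OF W(3)] by (simp add: pre_digraph.cas.simps drop_Suc)
qed

lemma exists_between_finite_sets:
  fixes L U :: "'a::{unbounded_dense_linorder} set"
  assumes "finite L" and "finite U" and "\<And>l r. l \<in> L \<Longrightarrow> r \<in> U \<Longrightarrow> l < r"
  shows "\<exists>x. (\<forall>l\<in>L. l < x) \<and> (\<forall>r\<in>U. x < r)"
proof (cases "L = {}")
  case True
  obtain x where "U \<noteq> {} \<longrightarrow> x < Min U" using lt_ex by blast
  then have "\<forall>r\<in>U. x < r" using assms(2) by auto
  then show ?thesis using True by blast
next
  case L: False
  show ?thesis
  proof (cases "U = {}")
    case True
    obtain x where "Max L < x" using gt_ex by blast
    then show ?thesis using True L assms(1) by auto
  next
    case False
    then have "Max L < Min U" using assms L by simp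
    then obtain x where "Max L < x" "x < Min U" using dense by blast
    then show ?thesis using False L assms(1,2) by auto
  qed
qed

text \<open>
  A letter in prescribed relative position can always be put in front of a word of rationals:
  if it is not forced to equal an existing letter, it goes between the smaller and the larger ones.
\<close>

lemma order_iso_Cons_extend:
  fixes u :: "rat list" and e :: "nat list"
  assumes "order_iso u (tl e)" and "e \<noteq> []"
  shows "\<exists>x. order_iso (x # u) e"
proof -
  obtain y v where e: "e = y # v" using assms(2) by (cases e) auto
  have uv: "order_iso u v" using assms e by simp
  then have len: "length u = length v" by (rule order_iso_length)
  have "\<exists>x. \<forall>b<length v. (x < u ! b \<longleftrightarrow> y < v ! b) \<and> (u ! b < x \<longleftrightarrow> v ! b < y)"
  proof (cases "y \<in> set v")
    case True
    then obtain k where k: "k < length v" "v ! k = y" by (auto simp: in_set_conv_nth)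
    then show ?thesis using order_iso_less[OF uv] by (intro exI[of _ "u ! k"]) blast
  next
    case False
    let ?L = "{u ! b |b. b < length v \<and> v ! b < y}" and ?U = "{u ! b |b. b < length v \<and> y < v ! b}"
    have "\<exists>x. (\<forall>l\<in>?L. l < x) \<and> (\<forall>r\<in>?U. x < r)"
      using order_iso_less[OF uv] by (intro exists_between_finite_sets) fastforce+
    then obtain x where x: "\<forall>l\<in>?L. l < x" "\<forall>r\<in>?U. x < r" by blast
    have "(x < u ! b \<longleftrightarrow> y < v ! b) \<and> (u ! b < x \<longleftrightarrow> v ! b < y)" if "b < length v" for b
    proof -
      have "v ! b \<noteq> y" using False that nth_mem by blast
      then consider "v ! b < y" | "y < v ! b" by linarith
      then show ?thesis using x that by cases (auto dest: less_imp_not_less)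
    qed
    then show ?thesis by blast
  qed
  then obtain x where x: "\<forall>b<length v. (x < u ! b \<longleftrightarrow> y < v ! b) \<and> (u ! b < x \<longleftrightarrow> v ! b < y)" by blast
  have "order_iso (x # u) e"
    using x order_iso_less[OF uv] len by (auto simp: order_iso_def e nth_Cons split: nat.split)
  then show ?thesis by blast
qed

text \<open>
  Conversely, every walk in the graph of patterns comes from a linear word, which is
  built from its last letter backwards.
\<close>

lemma cas_imp_realizes:
  assumes "pre_digraph.cas (pattern_graph m A) \<sigma> es \<tau>" and "\<And>e. e \<in> set es \<Longrightarrow> length e = Suc m"
    and "\<tau> \<in> perms m"
  shows "\<exists>W::rat list. realizes m W es \<and> std (take m W) = \<sigma> \<and> std (drop (length es) W) = \<tau>"
  using assms
proof (induction es arbitrary: \<sigma>)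
  case Nil
  have "order_iso (map rat_of_nat \<tau>) \<tau>" by (rule order_iso_map) simp
  then have "std (map rat_of_nat \<tau>) = \<tau>" using std_eq_perm Nil by blast
  moreover have "length (map rat_of_nat \<tau>) = m" using Nil by (simp add: length_perms)
  moreover have "\<sigma> = \<tau>" using Nil by (simp add: pre_digraph.cas.simps)
  ultimately show ?case by (intro exI[of _ "map rat_of_nat \<tau>"]) (simp add: realizes_def)
next
  case (Cons e es)
  have \<sigma>: "\<sigma> = std (butlast e)" and "pre_digraph.cas (pattern_graph m A) (std (tl e)) es \<tau>"
    using Cons.prems(1) by (simp_all add: pre_digraph.cas.simps)
  with Cons obtain W :: "rat list" where W: "realizes m W es" "std (take m W) = std (tl e)"
      "std (drop (length es) W) = \<tau>"
    by (metis list.set_intros(2))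
  have le: "length e = Suc m" using Cons by simp
  have lW: "length W = length es + m" using W(1) by (simp add: realizes_def)
  have "order_iso (take m W) (tl e)"
    using order_iso_std[of "take m W"] order_iso_std[of "tl e"] W(2) by (metis order_iso_sym order_iso_trans)
  then obtain x where x: "order_iso (x # take m W) e" using order_iso_Cons_extend le by fastforce
  have "butlast (x # take m W) = take m (x # W)"
    using lW by (cases m) (auto simp: butlast_take)
  then have "std (take m (x # W)) = \<sigma>" using std_cong[OF order_iso_butlast[OF x]] \<sigma> by simp
  moreover have "realizes m (x # W) (e # es)" using x W(1) by (simp add: realizes_Cons)
  ultimately show ?case using W(3) by (intro exI[of _ "x # W"]) simp
qed

section \<open>Windows as arcs\<close>

text \<open>
  As a window, \<open>merged \<sigma>\<close> has equal ends and represents both permutations whose ends are adjacent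
  values and whose first \<open>m\<close> letters have pattern \<open>\<sigma>\<close>.
\<close>

definition merged :: "nat list \<Rightarrow> nat list" where
  "merged \<sigma> = \<sigma> @ [hd \<sigma>]"

text \<open>
  The patterns in \<open>C\<close> are those at which the two parallel arcs to the rotation are merged.
\<close>

definition window_arcs :: "nat \<Rightarrow> nat list set \<Rightarrow> nat list set" where
  "window_arcs m C = merged ` C \<union> {\<pi> \<in> perms (Suc m). \<forall>\<sigma>\<in>C. \<not> covers (merged \<sigma>) \<pi>}"

text \<open>
  Appending a last letter of rank \<open>k\<close> makes the letters of rank at least \<open>k\<close> move up. Every arc
  that is a permutation has this form for its tail \<open>\<sigma>\<close>.
\<close>

definition append_rank :: "nat list \<Rightarrow> nat \<Rightarrow> nat list" where
  "append_rank \<sigma> k = map (\<lambda>x. if k \<le> x then Suc x else x) \<sigma> @ [k]"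

lemma covers_order_iso:
  assumes "order_iso u v"
  shows "covers u p \<longleftrightarrow> covers v p"
  using assms by (simp add: covers_def order_iso_def)

lemma covers_distinct:
  assumes "covers u p" and "distinct u"
  shows "order_iso u p"
proof -
  have "u ! a < u ! b \<longleftrightarrow> p ! a < p ! b" if ab: "a < length u" "b < length u" for a b
  proof (cases "a = b")
    case False
    then have "u ! a < u ! b \<or> u ! b < u ! a"
      using assms(2) ab by (simp add: nth_eq_iff_index_eq neq_iff[symmetric])
    then show ?thesis using assms(1) ab by (auto simp: covers_def dest: less_imp_not_less)
  qed simp
  then show ?thesis using assms(1) by (simp add: order_iso_def covers_def)
qed

lemma covers_butlast: "covers u p \<Longrightarrow> covers (butlast u) (butlast p)"
  by (auto simp: covers_def nth_butlast)

lemma covers_rev: "covers (rev u) (rev p) \<longleftrightarrow> covers u p"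
proof -
  have "covers (rev u) (rev p)" if "covers u p" for u p
    using that by (auto simp: covers_def rev_nth)
  from this this[of "rev u" "rev p"] show ?thesis by auto
qed

lemma perms_covers_perms: "\<pi> \<in> perms m \<Longrightarrow> \<rho> \<in> perms m \<Longrightarrow> covers \<pi> \<rho> \<longleftrightarrow> \<pi> = \<rho>"
  using covers_distinct[of \<pi> \<rho>] std_eq_perm std_perms
  by (metis covers_def perms_iff)

lemma covers_merged_imp_tail:
  assumes "\<sigma> \<in> perms m" and "covers (merged \<sigma>) \<pi>"
  shows "std (butlast \<pi>) = \<sigma>"
proof -
  have "covers \<sigma> (butlast \<pi>)" using covers_butlast[OF assms(2)] by (simp add: merged_def)
  then have "order_iso \<sigma> (butlast \<pi>)" using assms(1) by (simp add: covers_distinct perms_iff)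
  then show ?thesis using assms(1) std_cong std_perms by metis
qed

lemma append_rank_perms:
  assumes "\<sigma> \<in> perms m" and "k \<in> {1..Suc m}"
  shows "append_rank \<sigma> k \<in> perms (Suc m)"
proof -
  let ?f = "\<lambda>x. if k \<le> x then Suc x else x"
  have d: "distinct (append_rank \<sigma> k)"
    using assms(1) by (auto simp: append_rank_def perms_iff distinct_map inj_on_def split: if_splits)
  have "set (append_rank \<sigma> k) \<subseteq> {1..Suc m}"
    using assms by (auto simp: append_rank_def perms_iff)
  moreover have "card (set (append_rank \<sigma> k)) = Suc m"
    unfolding distinct_card[OF d] using length_perms[OF assms(1)] by (simp add: append_rank_def)
  ultimately have "set (append_rank \<sigma> k) = {1..Suc m}" by (intro card_subset_eq) auto
  with d show ?thesis by (simp add: perms_iff)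
qed

lemma std_butlast_append_rank:
  assumes "\<sigma> \<in> perms m"
  shows "std (butlast (append_rank \<sigma> k)) = \<sigma>"
proof -
  have "order_iso (map (\<lambda>x. if k \<le> x then Suc x else x) \<sigma>) \<sigma>" by (rule order_iso_map) auto
  then show ?thesis using assms std_eq_perm by (simp add: append_rank_def)
qed

lemma set_butlast_perms:
  assumes "\<pi> \<in> perms (Suc m)"
  shows "distinct (butlast \<pi>)" "set (butlast \<pi>) = {1..Suc m} - {last \<pi>}" "last \<pi> \<in> {1..Suc m}"
proof -
  have "\<pi> \<noteq> []" using length_perms[OF assms] by auto
  then obtain w k where "\<pi> = w @ [k]" by (cases \<pi> rule: rev_cases) auto
  then show "distinct (butlast \<pi>)" "set (butlast \<pi>) = {1..Suc m} - {last \<pi>}" "last \<pi> \<in> {1..Suc m}"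
    using assms by (auto simp: perms_iff)
qed

lemma append_rank_std_butlast:
  assumes "\<pi> \<in> perms (Suc m)"
  shows "append_rank (std (butlast \<pi>)) (last \<pi>) = \<pi>"
proof -
  have "\<pi> \<noteq> []" using length_perms[OF assms] by auto
  note b = set_butlast_perms[OF assms]
  have "(if last \<pi> \<le> (if last \<pi> < x then x - 1 else x)
         then Suc (if last \<pi> < x then x - 1 else x) else (if last \<pi> < x then x - 1 else x)) = x"
    if "x \<in> set (butlast \<pi>)" for x
    using that unfolding b(2) by auto
  then have "append_rank (std (butlast \<pi>)) (last \<pi>) = butlast \<pi> @ [last \<pi>]"
    unfolding std_upt_minus[OF b] append_rank_def map_map comp_def
    by (simp only: map_idI)
  then show ?thesis using \<open>\<pi> \<noteq> []\<close> by simp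
qed

text \<open>
  Covering fixes the comparison of the last letter with every letter of \<open>\<sigma>\<close> except the first, so
  only the two ranks directly below and above that first letter are possible.
\<close>

lemma covers_merged_append_rank:
  assumes "\<sigma> \<in> perms m" and "0 < m" and "k \<in> {1..Suc m}"
  shows "covers (merged \<sigma>) (append_rank \<sigma> k) \<longleftrightarrow> k = hd \<sigma> \<or> k = Suc (hd \<sigma>)"
proof -
  define f where "f x = (if k \<le> x then Suc x else x)" for x
  have len: "length \<sigma> = m" using length_perms[OF assms(1)] .
  have hd: "hd \<sigma> = \<sigma> ! 0" using len assms(2) by (intro hd_conv_nth) auto
  have h: "1 \<le> hd \<sigma>" "hd \<sigma> \<le> m"
    using nth_mem[of 0 \<sigma>] assms(1,2) len hd by (auto simp: perms_iff)
  have mono: "f x < f y \<longleftrightarrow> x < y" for x y by (auto simp: f_def)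
  have e: "append_rank \<sigma> k = map f \<sigma> @ [k]" by (simp add: append_rank_def f_def[abs_def])
  have "covers (merged \<sigma>) (append_rank \<sigma> k) \<longleftrightarrow>
      (\<forall>x\<in>set \<sigma>. (x < hd \<sigma> \<longrightarrow> f x < k) \<and> (hd \<sigma> < x \<longrightarrow> k < f x))"
    unfolding e merged_def covers_def
    by (auto simp: less_Suc_eq nth_append len mono all_set_conv_all_nth)
  also have "\<dots> \<longleftrightarrow> (\<forall>x\<in>{1..m}. (x < hd \<sigma> \<longrightarrow> x < k) \<and> (hd \<sigma> < x \<longrightarrow> k \<le> x))"
    using assms(1) by (auto simp: perms_iff f_def)
  also have "\<dots> \<longleftrightarrow> k = hd \<sigma> \<or> k = Suc (hd \<sigma>)"
  proof
    assume *: "\<forall>x\<in>{1..m}. (x < hd \<sigma> \<longrightarrow> x < k) \<and> (hd \<sigma> < x \<longrightarrow> k \<le> x)"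
    have "hd \<sigma> - 1 < k"
    proof (cases "hd \<sigma> = 1")
      case False
      then have "hd \<sigma> - 1 \<in> {1..m}" "hd \<sigma> - 1 < hd \<sigma>" using h by auto
      then show ?thesis using * by blast
    qed (use assms(3) in auto)
    moreover have "k \<le> Suc (hd \<sigma>)"
      using bspec[OF *, of "Suc (hd \<sigma>)"] h assms(3) by (cases "hd \<sigma> = m") auto
    ultimately show "k = hd \<sigma> \<or> k = Suc (hd \<sigma>)" using h by linarith
  qed auto
  finally show ?thesis .
qed

text \<open>
  A permutation arc with tail \<open>\<sigma>\<close> is determined by the rank of its last letter. This gives \<open>m + 1\<close>
  arcs, of which two are replaced by one if \<open>\<sigma>\<close> belongs to \<open>C\<close>.
\<close>

lemma out_degree_window_arcs:
  assumes "C \<subseteq> perms m" and "0 < m" and "\<sigma> \<in> perms m"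
  shows "card {e \<in> window_arcs m C. std (butlast e) = \<sigma>} + (if \<sigma> \<in> C then 1 else 0) = Suc m"
proof -
  have inj: "inj_on (append_rank \<sigma>) K" for K by (auto simp: inj_on_def append_rank_def)
  have tail_merged: "std (butlast (merged \<tau>)) = \<tau>" if "\<tau> \<in> C" for \<tau>
    using that assms(1) by (auto simp: merged_def std_perms)
  have uncovered: "{\<pi> \<in> perms (Suc m). (\<forall>\<tau>\<in>C. \<not> covers (merged \<tau>) \<pi>) \<and> std (butlast \<pi>) = \<sigma>}
      = append_rank \<sigma> ` {k \<in> {1..Suc m}. \<sigma> \<in> C \<longrightarrow> k \<noteq> hd \<sigma> \<and> k \<noteq> Suc (hd \<sigma>)}" (is "?U = append_rank \<sigma> ` ?K")
  proof (intro equalityI subsetI)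
    fix \<pi> assume \<pi>: "\<pi> \<in> ?U"
    then have "\<pi> = append_rank \<sigma> (last \<pi>)" "last \<pi> \<in> {1..Suc m}"
      using append_rank_std_butlast[of \<pi> m] set_butlast_perms(3)[of \<pi> m] by auto
    moreover from this have "last \<pi> \<in> ?K"
      using \<pi> covers_merged_append_rank[OF assms(3,2), of "last \<pi>"] by fastforce
    ultimately show "\<pi> \<in> append_rank \<sigma> ` ?K" by blast
  next
    fix \<pi> assume "\<pi> \<in> append_rank \<sigma> ` ?K"
    then obtain k where k: "k \<in> ?K" "\<pi> = append_rank \<sigma> k" by blast
    then have "\<pi> \<in> perms (Suc m)" "std (butlast \<pi>) = \<sigma>"
      using append_rank_perms assms(3) std_butlast_append_rank by auto
    moreover have "\<not> covers (merged \<tau>) \<pi>" if "\<tau> \<in> C" for \<tau>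
    proof
      assume c: "covers (merged \<tau>) \<pi>"
      have "\<tau> = \<sigma>"
        using covers_merged_imp_tail[OF _ c] that assms(1) \<open>std (butlast \<pi>) = \<sigma>\<close> by auto
      then show False using c that k covers_merged_append_rank[OF assms(3,2), of k] by auto
    qed
    ultimately show "\<pi> \<in> ?U" by blast
  qed
  have eq: "{e \<in> window_arcs m C. std (butlast e) = \<sigma>} = merged ` (C \<inter> {\<sigma>}) \<union> ?U"
    using tail_merged by (auto simp: window_arcs_def)
  have "merged \<tau> \<notin> perms (Suc m)" for \<tau>
    using length_perms[of "merged \<tau>" "Suc m"] assms(2)
    by (cases \<tau>) (auto simp: merged_def perms_iff)
  then have "card {e \<in> window_arcs m C. std (butlast e) = \<sigma>} = card (C \<inter> {\<sigma>}) + card ?K"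
  proof -
    assume *: "merged \<tau> \<notin> perms (Suc m)" for \<tau>
    have "card (merged ` (C \<inter> {\<sigma>})) = card (C \<inter> {\<sigma>})"
      by (intro card_image) (auto simp: inj_on_def)
    moreover have "card ?U = card ?K" unfolding uncovered by (rule card_image[OF inj])
    moreover have "finite ?U" unfolding uncovered by simp
    ultimately show ?thesis unfolding eq using * by (subst card_Un_disjoint) auto
  qed
  moreover have "card ?K = (if \<sigma> \<in> C then m - 1 else Suc m)"
  proof (cases "\<sigma> \<in> C")
    case True
    have "hd \<sigma> \<in> {1..m}"
      using assms(2,3) length_perms[OF assms(3)] hd_in_set[of \<sigma>] by (auto simp: perms_iff)
    moreover have "?K = {1..Suc m} - {hd \<sigma>, Suc (hd \<sigma>)}" using True by auto
    ultimately show ?thesis using True by (simp add: card_Diff_subset)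
  next
    case False
    then have "?K = {1..Suc m}" by auto
    then show ?thesis using False by simp
  qed
  ultimately show ?thesis using assms(2) by auto
qed

lemma finite_window_arcs [simp]: "C \<subseteq> perms m \<Longrightarrow> finite (window_arcs m C)"
  using finite_subset[of C "perms m"] by (simp add: window_arcs_def perms_def)

lemma length_window_arcs: "C \<subseteq> perms m \<Longrightarrow> e \<in> window_arcs m C \<Longrightarrow> length e = Suc m"
  using length_perms by (fastforce simp: window_arcs_def merged_def)

lemma distinct_butlast_window_arcs: "C \<subseteq> perms m \<Longrightarrow> e \<in> window_arcs m C \<Longrightarrow> distinct (butlast e)"
  by (auto simp: window_arcs_def merged_def perms_iff distinct_butlast)

lemma tl_merged: "\<sigma> \<noteq> [] \<Longrightarrow> tl (merged \<sigma>) = rotate1 \<sigma>"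
  by (cases \<sigma>) (auto simp: merged_def)

lemma rev_merged: "\<sigma> \<noteq> [] \<Longrightarrow> rev (merged \<sigma>) = merged (rev (rotate1 \<sigma>))"
  by (cases \<sigma>) (auto simp: merged_def)

lemma perms_nonempty: "\<sigma> \<in> perms m \<Longrightarrow> 0 < m \<Longrightarrow> \<sigma> \<noteq> []"
  using length_perms by fastforce

text \<open>
  Reversal exchanges heads and tails of arcs. It sends the arc merged at \<open>\<sigma>\<close> to the arc merged at
  the reversed rotation of \<open>\<sigma>\<close>, which is where closure of \<open>C\<close> under rotation enters.
\<close>

lemma rev_window_arcs:
  assumes "C \<subseteq> perms m" and "0 < m" and "rotate1 ` C = C"
  shows "window_arcs m (rev ` C) = rev ` window_arcs m C"
proof -
  have ne: "\<sigma> \<noteq> []" if "\<sigma> \<in> C" for \<sigma> using that assms perms_nonempty by blast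
  have m: "merged ` rev ` C = rev ` merged ` C"
  proof -
    have "merged ` rev ` C = merged ` rev ` rotate1 ` C" using assms(3) by simp
    also have "\<dots> = rev ` merged ` C" using rev_merged ne by (simp add: image_image)
    finally show ?thesis .
  qed
  have "(\<forall>\<sigma>\<in>rev ` C. \<not> covers (merged \<sigma>) \<pi>) \<longleftrightarrow> (\<forall>\<sigma>\<in>C. \<not> covers (merged \<sigma>) (rev \<pi>))" for \<pi>
  proof -
    have "(\<forall>\<sigma>\<in>rev ` C. \<not> covers (merged \<sigma>) \<pi>) \<longleftrightarrow> (\<forall>w\<in>merged ` rev ` C. \<not> covers w \<pi>)" by simp
    also have "\<dots> \<longleftrightarrow> (\<forall>\<sigma>\<in>C. \<not> covers (merged \<sigma>) (rev \<pi>))"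
      unfolding m using covers_rev[of _ "rev \<pi>"] by simp
    finally show ?thesis .
  qed
  moreover have "rev \<pi> \<in> perms n \<longleftrightarrow> \<pi> \<in> perms n" for \<pi> n by (simp add: perms_iff)
  ultimately have "{\<pi> \<in> perms (Suc m). \<forall>\<sigma>\<in>rev ` C. \<not> covers (merged \<sigma>) \<pi>}
      = rev ` {\<pi> \<in> perms (Suc m). \<forall>\<sigma>\<in>C. \<not> covers (merged \<sigma>) \<pi>}"
    by (auto intro!: image_eqI[of _ rev "rev _"])
  then show ?thesis using m by (simp add: window_arcs_def image_Un)
qed

lemma distinct_tl_window_arcs:
  assumes "C \<subseteq> perms m" and "0 < m" and "e \<in> window_arcs m C"
  shows "distinct (tl e)"
  using assms perms_nonempty[of _ m]
  by (auto simp: window_arcs_def tl_merged perms_iff distinct_tl)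

text \<open>
  By reversal this is the count of outgoing arcs, applied to the reversed patterns.
\<close>

lemma in_degree_window_arcs:
  assumes "C \<subseteq> perms m" and "0 < m" and "rotate1 ` C = C" and "\<sigma> \<in> perms m"
  shows "card {e \<in> window_arcs m C. std (tl e) = \<sigma>} + (if \<sigma> \<in> C then 1 else 0) = Suc m"
proof -
  have tail_rev: "std (butlast (rev e)) = rev (std (tl e))" if "e \<in> window_arcs m C" for e
    using std_rev[OF distinct_tl_window_arcs[OF assms(1,2) that]] by (simp add: butlast_rev)
  have "{e \<in> window_arcs m (rev ` C). std (butlast e) = rev \<sigma>}
      = rev ` {e \<in> window_arcs m C. std (tl e) = \<sigma>}"
    unfolding rev_window_arcs[OF assms(1-3)] using tail_rev by auto
  then have "card {e \<in> window_arcs m C. std (tl e) = \<sigma>}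
      = card {e \<in> window_arcs m (rev ` C). std (butlast e) = rev \<sigma>}"
    by (simp add: card_image)
  moreover have C': "rev ` C \<subseteq> perms m" and \<sigma>': "rev \<sigma> \<in> perms m"
    using assms(1,4) by (auto simp: perms_iff)
  have "rev \<sigma> \<in> rev ` C \<longleftrightarrow> \<sigma> \<in> C" by (auto simp: image_iff)
  ultimately show ?thesis using out_degree_window_arcs[OF C' assms(2) \<sigma>'] by simp
qed

lemma card_perms: "card (perms m) = fact m"
  by (simp add: perms_def)

lemma card_window_arcs:
  assumes "C \<subseteq> perms m" and "0 < m"
  shows "card (window_arcs m C) = fact (Suc m) - card C"
proof -
  have tail: "std (butlast e) \<in> perms m" if "e \<in> window_arcs m C" for e
    using std_in_perms[OF distinct_butlast_window_arcs[OF assms(1) that]] length_window_arcs[OF assms(1) that] by simp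
  have "card (window_arcs m C) = (\<Sum>\<sigma>\<in>perms m. card {e \<in> window_arcs m C. std (butlast e) = \<sigma>})"
    using sum.group[of "window_arcs m C" "perms m" "\<lambda>e. std (butlast e)" "\<lambda>_. 1::nat"] tail assms(1)
    by (simp add: image_subset_iff) (simp add: perms_def)
  moreover have "(\<Sum>\<sigma>\<in>perms m. if \<sigma> \<in> C then 1 else 0 :: nat) = card C"
    using assms(1) by (simp add: sum.If_cases perms_def Int_absorb1)
  moreover have "(\<Sum>\<sigma>\<in>perms m. card {e \<in> window_arcs m C. std (butlast e) = \<sigma>}) +
      (\<Sum>\<sigma>\<in>perms m. if \<sigma> \<in> C then 1 else 0) = (\<Sum>\<sigma>\<in>perms m. Suc m)"
    unfolding sum.distrib[symmetric] using out_degree_window_arcs[OF assms] by (intro sum.cong) auto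
  ultimately show ?thesis by (simp add: card_perms algebra_simps)
qed

text \<open>
  A permutation has \<open>m\<close> different rotations, so whole rotation classes can be collected one
  after the other until the \<open>m!\<close> permutations are exhausted.
\<close>

lemma exists_rotation_closed_set:
  assumes "0 < m" and "i \<le> fact (m - 1)"
  shows "\<exists>C \<subseteq> perms m. rotate1 ` C = C \<and> card C = i * m"
  using assms(2)
proof (induction i)
  case (Suc i)
  then obtain C where C: "C \<subseteq> perms m" "rotate1 ` C = C" "card C = i * m" by auto
  have "i * m < fact m"
    using Suc.prems assms(1) fact_reduce[of m, where 'a = nat] by (simp add: mult.commute)
  then have "C \<noteq> perms m" using C(3) card_perms by auto
  then obtain \<sigma> where \<sigma>: "\<sigma> \<in> perms m" "\<sigma> \<notin> C" using C(1) by blast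
  let ?R = "(\<lambda>k. rotate k \<sigma>) ` {..<m}"
  have len: "length \<sigma> = m" using length_perms \<sigma>(1) .
  have R: "?R \<subseteq> perms m" using \<sigma>(1) by (auto simp: perms_iff)
  have "card ?R = m"
  proof -
    have "inj_on (\<lambda>k. rotate k \<sigma>) {..<m}"
    proof (rule inj_onI)
      fix j k assume jk: "j \<in> {..<m}" "k \<in> {..<m}" "rotate j \<sigma> = rotate k \<sigma>"
      then have "\<sigma> ! j = \<sigma> ! k"
        using hd_rotate_conv_nth[of \<sigma> j] hd_rotate_conv_nth[of \<sigma> k] len by fastforce
      then show "j = k" using jk \<sigma>(1) len by (simp add: perms_iff nth_eq_iff_index_eq)
    qed
    then show ?thesis by (simp add: card_image)
  qed
  moreover have rot_R: "rotate1 ` ?R = ?R"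
  proof (rule card_subset_eq)
    show "rotate1 ` ?R \<subseteq> ?R"
    proof clarify
      fix k assume "k < m"
      have "rotate1 (rotate k \<sigma>) = rotate (Suc k mod m) \<sigma>"
        using rotate_conv_mod[of "Suc k" \<sigma>] len by simp
      then show "rotate1 (rotate k \<sigma>) \<in> ?R" using assms(1) by simp
    qed
  qed (auto intro!: card_image inj_on_subset[OF inj_rotate1])
  moreover have "C \<inter> ?R = {}"
  proof -
    have preimage: "\<tau> \<in> C" if "rotate1 \<tau> \<in> C" for \<tau>
    proof -
      have "rotate1 \<tau> \<in> rotate1 ` C" using that C(2) by simp
      then show ?thesis using inj_rotate1 by (auto dest: injD)
    qed
    have "rotate k \<sigma> \<notin> C" for k
      by (induction k) (auto simp: \<sigma>(2) dest: preimage)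
    then show ?thesis by blast
  qed
  moreover have "finite C" using finite_subset[OF C(1)] by (simp add: perms_def)
  ultimately have "card (C \<union> ?R) = Suc i * m" using C(3) by (simp add: card_Un_disjoint)
  moreover have "rotate1 ` (C \<union> ?R) = C \<union> ?R" unfolding image_Un C(2) rot_R ..
  ultimately show ?case using C(1) R by (intro exI[of _ "C \<union> ?R"]) auto
qed (intro exI[of _ "{}"], simp)

lemma window_arcs_cover_uniquely:
  assumes "C \<subseteq> perms m" and "\<pi> \<in> perms (Suc m)"
  shows "\<exists>!e. e \<in> window_arcs m C \<and> covers e \<pi>"
proof (cases "\<exists>\<sigma>\<in>C. covers (merged \<sigma>) \<pi>")
  case True
  then obtain \<sigma> where \<sigma>: "\<sigma> \<in> C" "covers (merged \<sigma>) \<pi>" by blast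
  have "e = merged \<sigma>" if e: "e \<in> window_arcs m C" "covers e \<pi>" for e
    using e(1) unfolding window_arcs_def
  proof
    assume "e \<in> merged ` C"
    then show ?thesis
      using covers_merged_imp_tail[of _ m \<pi>] \<sigma> e(2) assms(1) by blast
  next
    assume "e \<in> {\<pi> \<in> perms (Suc m). \<forall>\<sigma>\<in>C. \<not> covers (merged \<sigma>) \<pi>}"
    then show ?thesis using e(2) \<sigma> assms(2) perms_covers_perms by fastforce
  qed
  then show ?thesis using \<sigma> by (intro ex1I[of _ "merged \<sigma>"]) (auto simp: window_arcs_def)
next
  case False
  then show ?thesis using assms perms_covers_perms[of _ "Suc m" \<pi>]
    by (intro ex1I[of _ \<pi>]) (auto simp: window_arcs_def)
qed

lemma window_arcs_equal_letters:
  assumes "C \<subseteq> perms m" and "e \<in> window_arcs m C" and "a < b" and "b < Suc m" and "e ! a = e ! b"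
  shows "a = 0 \<and> b = m"
proof (cases "e \<in> perms (Suc m)")
  case True
  then show ?thesis using assms(3-5) length_perms[OF True] by (auto simp: perms_iff nth_eq_iff_index_eq)
next
  case False
  then obtain \<sigma> where \<sigma>: "\<sigma> \<in> perms m" "e = merged \<sigma>"
    using assms(1,2) by (auto simp: window_arcs_def)
  have len: "length \<sigma> = m" using length_perms \<sigma>(1) .
  have "b = m"
    using assms(3-5) \<sigma> len by (auto simp: merged_def nth_append perms_iff nth_eq_iff_index_eq less_Suc_eq)
  then have "\<sigma> ! a = \<sigma> ! 0"
    using assms(3,5) len \<sigma>(2) hd_conv_nth[of \<sigma>] by (cases "\<sigma> = []") (auto simp: merged_def nth_append)
  then show ?thesis using \<open>b = m\<close> assms(3) \<sigma>(1) len by (simp add: perms_iff nth_eq_iff_index_eq)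
qed

lemma shortened_ucycleI:
  assumes "C \<subseteq> perms m" and "set es = window_arcs m C" and "distinct es" and "length z = length es"
    and iso: "\<And>j. j < length z \<Longrightarrow> order_iso (cyclic_window (Suc m) z j) (es ! j)"
  shows "shortened_ucycle (Suc m) z"
  unfolding shortened_ucycle_def
proof (intro conjI allI impI ballI)
  fix j a b assume j: "j < length z"
    and ab: "a < b \<and> b < Suc m \<and> cyclic_window (Suc m) z j ! a = cyclic_window (Suc m) z j ! b"
  have e: "es ! j \<in> window_arcs m C" using j assms(2,4) nth_mem[of j es] by simp
  then have "length (es ! j) = Suc m" using length_window_arcs assms(1) by blast
  then have "es ! j ! a = es ! j ! b" using ab order_iso_eq[OF iso[OF j], of a b] by auto
  then have "a = 0 \<and> b = m" using window_arcs_equal_letters[OF assms(1) e] ab by blast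
  then show "a = 0" "b = Suc m - 1" by simp_all
next
  fix \<pi> assume "\<pi> \<in> permutations_of_set {1..Suc m}"
  then have "\<exists>!e. e \<in> window_arcs m C \<and> covers e \<pi>"
    using window_arcs_cover_uniquely[OF assms(1)] unfolding perms_def by blast
  then obtain e where e: "e \<in> set es" "covers e \<pi>" and u: "\<And>e'. e' \<in> set es \<Longrightarrow> covers e' \<pi> \<Longrightarrow> e' = e"
    unfolding assms(2) by blast
  obtain j where j: "j < length es" "es ! j = e" using e(1) by (auto simp: in_set_conv_nth)
  show "\<exists>!j. j < length z \<and> covers (cyclic_window (Suc m) z j) \<pi>"
  proof (rule ex1I[of _ j])
    show "j < length z \<and> covers (cyclic_window (Suc m) z j) \<pi>"
      using j e covers_order_iso[OF iso] assms(4) by simp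
  next
    fix k assume k: "k < length z \<and> covers (cyclic_window (Suc m) z k) \<pi>"
    then have "covers (es ! k) \<pi>" using covers_order_iso[OF iso[of k]] by simp
    then have "es ! k = es ! j" using u[of "es ! k"] k assms(4) j(2) by simp
    then show "k = j" using nth_eq_iff_index_eq[OF assms(3), of k j] assms(4) j k by simp
  qed
qed

lemma cyclic_window_conv_take_drop:
  assumes "j < length z" and "n \<le> Suc (length z)"
  shows "cyclic_window n z j = take n (drop j (z @ take (n - 1) z))"
proof (rule nth_equalityI)
  show "length (cyclic_window n z j) = length (take n (drop j (z @ take (n - 1) z)))"
    using assms by (auto simp: cyclic_window_def)
  fix k assume "k < length (cyclic_window n z j)"
  then have k: "k < n" by (simp add: cyclic_window_def)
  have "(j + k) mod length z = (if j + k < length z then j + k else j + k - length z)"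
    using assms k by (simp add: mod_if)
  then show "cyclic_window n z j ! k = take n (drop j (z @ take (n - 1) z)) ! k"
    using assms k by (auto simp: cyclic_window_def nth_append add.commute)
qed

lemma order_iso_cyclic_window:
  assumes "order_iso z z'" and "z \<noteq> []"
  shows "order_iso (cyclic_window n z j) (cyclic_window n z' j)"
proof -
  have "length z = length z'" "0 < length z'"
    using assms order_iso_length[OF assms(1)] by auto
  then show ?thesis using order_iso_less[OF assms(1)]
    by (simp add: order_iso_def cyclic_window_def)
qed

text \<open>
  In a balanced graph, removing a trail from \<open>u\<close> to \<open>v\<close> leaves exactly the imbalance for which
  Euler's theorem yields an open trail back from \<open>v\<close> to \<open>u\<close>.
\<close>

lemma (in fin_digraph) euler_trail_avoiding:
  assumes bal: "\<And>w. w \<in> verts G \<Longrightarrow> in_degree G w = out_degree G w"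
    and p: "trail u p v" and "u \<noteq> v"
    and con: "connected (G\<lparr>arcs := arcs G - set p\<rparr>)"
  shows "\<exists>q. pre_digraph.cas (G\<lparr>arcs := arcs G - set p\<rparr>) v q u \<and> distinct q \<and> set q = arcs G - set p"
proof -
  let ?H = "G\<lparr>arcs := arcs G - set p\<rparr>"
  interpret H: fin_digraph ?H
    by unfold_locales auto
  have "awalk u p v" using p by (simp add: trail_def)
  then have uv: "u \<in> verts G" "v \<in> verts G"
    using awalk_hd_in_verts awalk_last_in_verts by blast+
  have io: "in_arcs ?H w = in_arcs G w - set p" "out_arcs ?H w = out_arcs G w - set p" for w by auto
  have deg: "int (in_degree ?H w) - int (out_degree ?H w) = - arc_balance w p" if "w \<in> verts G" for w
  proof -
    have "card (in_arcs G w \<inter> set p) \<le> in_degree G w" "card (out_arcs G w \<inter> set p) \<le> out_degree G w"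
      unfolding in_degree_def out_degree_def by (auto intro!: card_mono)
    then show ?thesis using bal[OF that]
      unfolding in_degree_def out_degree_def arc_set_balance_def io
      by (simp add: card_Diff_subset_Int)
  qed
  note b = arc_balancedI_trail[OF p, unfolded arc_set_balanced_def if_not_P[OF \<open>u \<noteq> v\<close>]]
  have "\<exists>q. H.euler_trail v q u"
  proof (rule H.open_euler1[OF con])
    show "in_degree ?H w = out_degree ?H w" if "w \<in> verts ?H" "v \<noteq> w" "u \<noteq> w" for w
      using deg[of w] b that by auto
    show "in_degree ?H v + 1 = out_degree ?H v" using deg[OF uv(2)] b by linarith
    show "out_degree ?H u + 1 = in_degree ?H u" using deg[OF uv(1)] b by linarith
  qed (use uv in auto)
  then show ?thesis
    by (auto simp: H.euler_trail_def H.trail_def H.awalk_def)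
qed

section \<open>The reset trail\<close>

text \<open>
  The block \<open>2 1 3 \<dots> m\<close>, shifted above \<open>m\<close>. Its minimum is neither first nor last; both are
  needed for the windows that straddle the two block boundaries to be separated in the sense
  defined below.
\<close>

definition high :: "nat \<Rightarrow> nat list" where
  "high m = (m + 2) # (m + 1) # [m + 3..<Suc (2 * m)]"

definition rise :: "nat \<Rightarrow> nat list" where
  "rise m = [1..<Suc m] @ high m"

definition fall :: "nat \<Rightarrow> nat list" where
  "fall m = high m @ rev [1..<Suc m]"

definition reset_arcs :: "nat \<Rightarrow> nat list list" where
  "reset_arcs m = patterns m (rise m) @ patterns m (fall m)"

text \<open>
  An inner letter strictly between the two ends prevents a permutation from being covered by a window
  with equal ends, whichever patterns are merged.
\<close>

definition separated :: "nat \<Rightarrow> nat list \<Rightarrow> bool" where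
  "separated m e \<longleftrightarrow> (\<exists>c. 0 < c \<and> c < m \<and> (e ! 0 < e ! c \<and> e ! c < e ! m \<or> e ! m < e ! c \<and> e ! c < e ! 0))"

lemma separated_not_covered:
  assumes "separated m e" and "\<sigma> \<in> perms m"
  shows "\<not> covers (merged \<sigma>) e"
proof
  assume cov: "covers (merged \<sigma>) e"
  obtain c where c: "0 < c" "c < m" "e ! 0 < e ! c \<and> e ! c < e ! m \<or> e ! m < e ! c \<and> e ! c < e ! 0"
    using assms(1) by (auto simp: separated_def)
  have len: "length \<sigma> = m" using length_perms assms(2) .
  then have "hd \<sigma> = \<sigma> ! 0" using c by (intro hd_conv_nth) auto
  then have nth: "merged \<sigma> ! 0 = \<sigma> ! 0" "merged \<sigma> ! c = \<sigma> ! c" "merged \<sigma> ! m = \<sigma> ! 0"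
    and lm: "length (merged \<sigma>) = Suc m"
    using c len by (auto simp: merged_def nth_append)
  have mono: "e ! a < e ! b" if "a \<le> m" "b \<le> m" "merged \<sigma> ! a < merged \<sigma> ! b" for a b
    using cov that lm by (auto simp: covers_def)
  have "\<sigma> ! c \<noteq> \<sigma> ! 0" using assms(2) c len by (simp add: perms_iff nth_eq_iff_index_eq)
  then consider "\<sigma> ! c < \<sigma> ! 0" | "\<sigma> ! 0 < \<sigma> ! c" by linarith
  then show False
  proof cases
    case 1
    then have "e ! c < e ! 0" "e ! c < e ! m" using mono[of c 0] mono[of c m] c nth by auto
    then show False using c by auto
  next
    case 2
    then have "e ! 0 < e ! c" "e ! m < e ! c" using mono[of 0 c] mono[of m c] c nth by auto
    then show False using c by auto
  qed
qed

lemma length_patterns [simp]: "length (patterns m W) = length W - m"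
  by (simp add: patterns_def)

lemma patterns_nth:
  "j + m < length W \<Longrightarrow> patterns m W ! j = std (take (Suc m) (drop j W))"
  by (simp add: patterns_def less_diff_conv)

lemma patterns_nth_less:
  assumes "j + m < length W" and "a \<le> m" and "b \<le> m"
  shows "patterns m W ! j ! a < patterns m W ! j ! b \<longleftrightarrow> W ! (j + a) < W ! (j + b)"
  using order_iso_less[OF order_iso_std[of "take (Suc m) (drop j W)"], of a b] assms
  by (simp add: patterns_nth)

lemma patterns_perms:
  assumes "distinct W" and "j + m < length W"
  shows "patterns m W ! j \<in> perms (Suc m)"
proof -
  have "length (take (Suc m) (drop j W)) = Suc m" using assms(2) by simp
  then show ?thesis using std_in_perms[of "take (Suc m) (drop j W)"] assms by (simp only: patterns_nth) simp
qed

lemma length_high [simp]: "3 \<le> m \<Longrightarrow> length (high m) = m"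
  by (auto simp: high_def simp del: upt_Suc)

lemma length_rise [simp]: "3 \<le> m \<Longrightarrow> length (rise m) = 2 * m"
  by (simp add: rise_def)

lemma length_fall [simp]: "3 \<le> m \<Longrightarrow> length (fall m) = 2 * m"
  by (simp add: fall_def)

lemma high_nth:
  "t < m \<Longrightarrow> 3 \<le> m \<Longrightarrow> high m ! t = (if t = 0 then m + 2 else if t = 1 then m + 1 else m + t + 1)"
  by (auto simp: high_def nth_Cons nth_upt split: nat.splits simp del: upt_Suc)

lemma rise_nth:
  assumes "t < 2 * m" and "3 \<le> m"
  shows "rise m ! t = (if t = m then m + 2 else if t = Suc m then m + 1 else Suc t)"
proof (cases "t < m")
  case True
  then show ?thesis by (simp add: rise_def nth_append del: upt_Suc)
next
  case False
  then have "rise m ! t = high m ! (t - m)" by (simp add: rise_def nth_append del: upt_Suc)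
  then show ?thesis using False assms high_nth[of "t - m" m] by auto
qed

lemma fall_nth:
  assumes "t < 2 * m" and "3 \<le> m"
  shows "fall m ! t = (if m \<le> t then 2 * m - t else if t = 0 then m + 2 else if t = 1 then m + 1 else m + t + 1)"
  using assms high_nth[of t m]
  by (auto simp: fall_def nth_append rev_nth simp del: upt_Suc)

lemma distinct_high: "distinct (high m)"
  by (auto simp: high_def)

lemma high_greater: "x \<in> set (high m) \<Longrightarrow> m < x"
  by (auto simp: high_def)

lemma distinct_rise: "distinct (rise m)"
  using distinct_high by (auto simp: rise_def dest: high_greater simp del: upt_Suc)

lemma distinct_fall: "distinct (fall m)"
  using distinct_high by (auto simp: fall_def dest: high_greater simp del: upt_Suc)

lemma rise_ends:
  assumes "j < m" and "3 \<le> m"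
  shows "patterns m (rise m) ! j ! 0 < patterns m (rise m) ! j ! m"
  using assms by (auto simp: patterns_nth_less rise_nth)

lemma fall_ends:
  assumes "j < m" and "3 \<le> m"
  shows "patterns m (fall m) ! j ! m < patterns m (fall m) ! j ! 0"
  using assms by (auto simp: patterns_nth_less fall_nth)

lemma separated_rise:
  assumes "j < m" and "3 \<le> m"
  shows "separated m (patterns m (rise m) ! j)"
proof -
  \<comment> \<open>The witness is the last letter of the low block or, if that is the first letter of the
     window, the minimum of the high block.\<close>
  define c where "c = (if j = m - 1 then 2 else m - 1 - j)"
  have "0 < c" "c < m" using assms by (auto simp: c_def)
  moreover have "rise m ! (j + 0) < rise m ! (j + c) \<and> rise m ! (j + c) < rise m ! (j + m)"
  proof (cases "j = m - 1")
    case True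
    then have "j + 0 = m - 1" "j + c = Suc m" "j + m = 2 * m - 1" using assms by (simp_all add: c_def)
    then show ?thesis using assms by (simp only:) (auto simp: rise_nth)
  next
    case False
    then have "j + c = m - 1" "j < m - 1" using assms by (simp_all add: c_def)
    then show ?thesis using assms by (simp only:) (auto simp: rise_nth)
  qed
  ultimately show ?thesis
    unfolding separated_def using assms patterns_nth_less[of j m "rise m"]
    by (intro exI[of _ c]) simp
qed

lemma separated_fall:
  assumes "j < m" and "3 \<le> m"
  shows "separated m (patterns m (fall m) ! j)"
proof -
  \<comment> \<open>The witness is the minimum of the high block for the first window, and otherwise the
     first letter of the low block.\<close>
  define c where "c = (if j = 0 then 1 else m - j)"
  have "0 < c" "c < m" using assms by (auto simp: c_def)
  moreover have "fall m ! (j + m) < fall m ! (j + c) \<and> fall m ! (j + c) < fall m ! (j + 0)"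
    using assms by (auto simp: c_def fall_nth)
  ultimately show ?thesis
    unfolding separated_def using assms patterns_nth_less[of j m "fall m"]
    by (intro exI[of _ c]) simp
qed

lemma set_reset_arcs:
  assumes "3 \<le> m"
  shows "set (reset_arcs m) = (\<lambda>j. patterns m (rise m) ! j) ` {..<m} \<union> (\<lambda>j. patterns m (fall m) ! j) ` {..<m}"
proof -
  have "set xs = (\<lambda>j. xs ! j) ` {..<m}" if "length xs = m" for xs :: "nat list list"
    using that by (auto simp: set_conv_nth)
  then show ?thesis using assms by (simp add: reset_arcs_def)
qed

lemma reset_arcs_perms: "3 \<le> m \<Longrightarrow> e \<in> set (reset_arcs m) \<Longrightarrow> e \<in> perms (Suc m)"
  using patterns_perms[OF distinct_rise, of _ m m] patterns_perms[OF distinct_fall, of _ m m]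
  by (auto simp: set_reset_arcs)

lemma reset_arcs_separated: "3 \<le> m \<Longrightarrow> e \<in> set (reset_arcs m) \<Longrightarrow> separated m e"
  using separated_rise separated_fall by (auto simp: set_reset_arcs)

text \<open>
  The two halves of the trail differ in which end of the window is larger. Within each half, the
  windows are told apart by the positions of their descents: the rising word has a single descent,
  inside the high block, and the falling word has one at its start and then only from the top
  letter onwards.
\<close>

lemma distinct_reset_arcs:
  assumes m: "3 \<le> m"
  shows "distinct (reset_arcs m)"
proof -
  have R: "patterns m (rise m) ! j \<noteq> patterns m (rise m) ! k" if "j < k" "k < m" for j k
  proof
    assume eq: "patterns m (rise m) ! j = patterns m (rise m) ! k"
    have "rise m ! (j + Suc (m - k)) < rise m ! (j + (m - k)) \<longleftrightarrow> rise m ! (k + Suc (m - k)) < rise m ! (k + (m - k))"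
      using patterns_nth_less[of j m "rise m" "Suc (m - k)" "m - k"]
        patterns_nth_less[of k m "rise m" "Suc (m - k)" "m - k"] eq that m by simp
    then show False using that m by (auto simp: rise_nth split: if_splits)
  qed
  have F: "patterns m (fall m) ! j \<noteq> patterns m (fall m) ! k" if jk: "j < k" "k < m" for j k
  proof
    assume eq: "patterns m (fall m) ! j = patterns m (fall m) ! k"
    have cmp: "fall m ! (j + Suc s) < fall m ! (j + s) \<longleftrightarrow> fall m ! (k + Suc s) < fall m ! (k + s)"
      if "s < m" for s
      using patterns_nth_less[of j m "fall m" "Suc s" s]
        patterns_nth_less[of k m "fall m" "Suc s" s] eq jk that m by simp
    \<comment> \<open>Compare at the step down from the top letter in the later window. Only for these two extreme
       windows does the earlier one descend there as well.\<close>
    show False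
    proof (cases "j = 0 \<and> k = m - 1")
      case True
      then show False using cmp[of 1] m by (auto simp: fall_nth split: if_splits)
    next
      case False
      then show False using cmp[of "m - 1 - k"] jk m by (auto simp: fall_nth split: if_splits)
    qed
  qed
  have inj: "distinct xs" if "length xs = m" "\<And>j k. j < k \<Longrightarrow> k < m \<Longrightarrow> xs ! j \<noteq> xs ! k" for xs :: "nat list list"
    using that unfolding distinct_conv_nth by (metis nat_neq_iff)
  have "patterns m (rise m) ! j \<noteq> patterns m (fall m) ! k" if "j < m" "k < m" for j k
    using rise_ends[OF that(1) m] fall_ends[OF that(2) m] by auto
  then have "set (patterns m (rise m)) \<inter> set (patterns m (fall m)) = {}"
    using m by (fastforce simp: set_conv_nth)
  then show ?thesis using inj R F m by (simp add: reset_arcs_def)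
qed

lemma realizes_reset:
  assumes "3 \<le> m"
  shows "realizes m ([1..<Suc m] @ high m @ rev [1..<Suc m]) (reset_arcs m)"
  unfolding reset_arcs_def
proof (rule realizes_append)
  show "realizes m ([1..<Suc m] @ high m) (patterns m (rise m))"
    using realizes_patterns[of m "rise m"] assms by (simp add: rise_def del: upt_Suc)
  show "realizes m (high m @ rev [1..<Suc m]) (patterns m (fall m))"
    using realizes_patterns[of m "fall m"] assms by (simp add: fall_def del: upt_Suc)
qed (use assms in simp)

lemma upt_perms: "[1..<Suc m] \<in> perms m"
  by (auto simp: perms_iff)

lemma reset_arcs_window_arcs:
  assumes "3 \<le> m" and "C \<subseteq> perms m"
  shows "set (reset_arcs m) \<subseteq> window_arcs m C"
  using assms reset_arcs_perms reset_arcs_separated separated_not_covered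
  by (fastforce simp: window_arcs_def)

lemma reset_trail:
  assumes "3 \<le> m" and "C \<subseteq> perms m"
  shows "pre_digraph.trail (pattern_graph m (window_arcs m C)) [1..<Suc m] (reset_arcs m) (rev [1..<Suc m])"
proof -
  have "std [1..<Suc m] = [1..<Suc m]" "std (rev [1..<Suc m]) = rev [1..<Suc m]"
    using std_perms[OF upt_perms] std_rev[of "[1..<Suc m]"] by (simp_all del: upt_Suc)
  moreover have "length (reset_arcs m) = 2 * m" using assms(1) by (simp add: reset_arcs_def)
  ultimately have "pre_digraph.cas (pattern_graph m (window_arcs m C)) [1..<Suc m] (reset_arcs m) (rev [1..<Suc m])"
    using realizes_imp_cas[OF realizes_reset[OF assms(1)], of "window_arcs m C"] assms(1)
    by (simp del: upt_Suc)
  then show ?thesis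
    using assms distinct_reset_arcs reset_arcs_window_arcs upt_perms
    by (simp add: pre_digraph.trail_def pre_digraph.awalk_def del: upt_Suc)
qed

section \<open>Connectivity outside the reset trail\<close>

definition linked :: "nat list set \<Rightarrow> nat list \<Rightarrow> nat list \<Rightarrow> bool" where
  "linked A = equivclp (\<lambda>\<sigma> \<tau>. \<exists>e\<in>A. std (butlast e) = \<sigma> \<and> std (tl e) = \<tau>)"

lemma linked_refl: "linked A \<sigma> \<sigma>"
  by (simp add: linked_def)

lemma linked_sym: "linked A \<sigma> \<tau> \<Longrightarrow> linked A \<tau> \<sigma>"
  unfolding linked_def by (rule equivclp_sym)

lemma linked_trans [trans]: "linked A \<sigma> \<tau> \<Longrightarrow> linked A \<tau> \<rho> \<Longrightarrow> linked A \<sigma> \<rho>"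
  unfolding linked_def by (rule equivclp_trans)

lemma linked_arc: "e \<in> A \<Longrightarrow> std (butlast e) = \<sigma> \<Longrightarrow> std (tl e) = \<tau> \<Longrightarrow> linked A \<sigma> \<tau>"
  unfolding linked_def by (rule r_into_equivclp) blast

lemma tl_append_rank: "\<sigma> \<noteq> [] \<Longrightarrow> tl (append_rank \<sigma> k) = map (\<lambda>x. if k \<le> x then Suc x else x) (tl \<sigma>) @ [k]"
  by (cases \<sigma>) (auto simp: append_rank_def)

lemma rotate1_conv: "\<sigma> \<noteq> [] \<Longrightarrow> rotate1 \<sigma> = tl \<sigma> @ [hd \<sigma>]"
  by (cases \<sigma>) auto

text \<open>
  An appended letter adjacent in value to the first one takes over the place of the first one
  when that one is dropped.
\<close>

lemma std_tl_append_rank_hd: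
  assumes "\<sigma> \<in> perms m" and "0 < m"
  shows "std (tl (append_rank \<sigma> (hd \<sigma>))) = rotate1 \<sigma>"
proof -
  define g where "g x = (if hd \<sigma> < x then Suc x else x)" for x
  have ne: "\<sigma> \<noteq> []" using perms_nonempty assms by blast
  have "(if hd \<sigma> \<le> x then Suc x else x) = g x" if "x \<in> set (tl \<sigma>)" for x
    using that assms(1) ne by (cases \<sigma>) (auto simp: g_def perms_iff)
  then have "tl (append_rank \<sigma> (hd \<sigma>)) = map g (rotate1 \<sigma>)"
    using ne by (simp add: tl_append_rank rotate1_conv) (simp add: g_def)
  moreover have "order_iso (map g (rotate1 \<sigma>)) (rotate1 \<sigma>)"
    by (rule order_iso_map) (auto simp: g_def)
  moreover have "rotate1 \<sigma> \<in> perms m" using assms(1) by (simp add: perms_iff)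
  ultimately show ?thesis using std_eq_perm by metis
qed

text \<open>
  Appending a letter that exceeds the first letter \<open>a\<close> by two puts it just above the former value
  \<open>a + 1\<close>. Compared with plain rotation, the values \<open>a\<close> and \<open>a + 1\<close> have changed places.
\<close>

lemma std_tl_append_rank_swap:
  assumes "\<sigma> \<in> perms m" and "hd \<sigma> = a" and "0 < m" and "a < m"
  shows "std (tl (append_rank \<sigma> (a + 2))) = rotate1 (map (transpose a (Suc a)) \<sigma>)"
proof -
  let ?s = "transpose a (Suc a)"
  define g where "g x = (if a \<le> x then Suc x else x)" for x
  have ne: "\<sigma> \<noteq> []" using perms_nonempty assms by blast
  have "(if a + 2 \<le> x then Suc x else x) = g (?s x)" if "x \<in> set (tl \<sigma>)" for x
  proof -
    have "x \<noteq> a" using that assms(1,2) ne by (cases \<sigma>) (auto simp: perms_iff)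
    then show ?thesis by (auto simp: g_def transpose_def)
  qed
  then have "map (\<lambda>x. if a + 2 \<le> x then Suc x else x) (tl \<sigma>) = map g (map ?s (tl \<sigma>))" by simp
  then have "tl (append_rank \<sigma> (a + 2)) = map g (map ?s (tl \<sigma>) @ [?s a])"
    unfolding tl_append_rank[OF ne] by (simp add: g_def)
  then have "tl (append_rank \<sigma> (a + 2)) = map g (rotate1 (map ?s \<sigma>))"
    using ne assms(2) by (simp add: rotate1_conv map_tl hd_map)
  moreover have "order_iso (map g (rotate1 (map ?s \<sigma>))) (rotate1 (map ?s \<sigma>))"
    by (rule order_iso_map) (auto simp: g_def)
  moreover have "a \<in> {1..m}" using assms ne hd_in_set[OF ne] by (auto simp: perms_iff)
  then have "?s permutes {1..m}" using assms(4) by (intro permutes_swap_id) auto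
  then have "rotate1 (map ?s \<sigma>) \<in> perms m"
    using assms(1) permutes_image[of ?s "{1..m}"] by (auto simp: perms_iff distinct_map permutes_inj_on)
  ultimately show ?thesis using std_eq_perm by metis
qed

text \<open>
  The ends of such an arc differ by two, so at most one letter lies strictly between them. In the
  rising half of the trail, all windows except the first two have two such letters, the first two
  letters of the high block. The first two windows have increasing tails, and in the falling half
  the last letter is the smaller one.
\<close>

lemma append_rank_swap_not_reset:
  assumes "3 \<le> m" and \<sigma>: "\<sigma> \<in> perms m" and "hd \<sigma> = a" and "\<sigma> \<noteq> [1..<Suc m]"
  shows "append_rank \<sigma> (a + 2) \<notin> set (reset_arcs m)"
proof
  let ?e = "append_rank \<sigma> (a + 2)"
  assume "?e \<in> set (reset_arcs m)"
  have len: "length \<sigma> = m" using length_perms \<sigma> .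
  have "hd \<sigma> = \<sigma> ! 0" using len assms(1) by (intro hd_conv_nth) auto
  then have e: "?e ! 0 = a" "?e ! m = a + 2" using len assms(1,3) by (auto simp: append_rank_def nth_append)
  then obtain j where j: "j < m" "?e = patterns m (rise m) ! j"
    using \<open>?e \<in> _\<close> fall_ends[OF _ assms(1)] by (fastforce simp: set_reset_arcs[OF assms(1)])
  have less: "?e ! x < ?e ! y \<longleftrightarrow> rise m ! (j + x) < rise m ! (j + y)" if "x \<le> m" "y \<le> m" for x y
    using patterns_nth_less[of j m "rise m" x y] j that assms(1) by simp
  show False
  proof (cases "j < 2")
    case True
    have "order_iso (butlast ?e) [1..<Suc m]"
      unfolding order_iso_def
    proof (intro conjI allI impI)
      fix x y assume "x < length (butlast ?e)" "y < length (butlast ?e)"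
      then have xy: "x < m" "y < m" using len by (simp_all add: append_rank_def)
      then have "?e ! x < ?e ! y \<longleftrightarrow> x < y"
        using less[of x y] True assms(1) by (auto simp: rise_nth)
      moreover have "butlast ?e ! x = ?e ! x" "butlast ?e ! y = ?e ! y"
        using xy len by (auto simp: append_rank_def nth_append)
      ultimately show "butlast ?e ! x < butlast ?e ! y \<longleftrightarrow> [1..<Suc m] ! x < [1..<Suc m] ! y"
        using xy by (simp del: upt_Suc)
    qed (use len in \<open>simp add: append_rank_def\<close>)
    then have "std (butlast ?e) = [1..<Suc m]" using std_eq_perm upt_perms by blast
    then show False using assms(4) std_butlast_append_rank[OF \<sigma>] by metis
  next
    case False
    have "a < ?e ! (m - j) \<and> ?e ! (m - j) < a + 2" "a < ?e ! (Suc m - j) \<and> ?e ! (Suc m - j) < a + 2"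
      using less[of 0 "m - j"] less[of "m - j" m] less[of 0 "Suc m - j"] less[of "Suc m - j" m] e False j(1) assms(1)
      by (auto simp: rise_nth)
    then have "\<not> ?e ! (Suc m - j) < ?e ! (m - j)" by linarith
    moreover have "Suc m - j \<le> m" "m - j \<le> m" using False by simp_all
    ultimately have "\<not> rise m ! (j + (Suc m - j)) < rise m ! (j + (m - j))" using less by blast
    then show False using j(1) assms(1) by (simp add: rise_nth)
  qed
qed

context
  fixes m :: nat and C :: "nat list set"
  assumes m: "3 \<le> m" and C: "C \<subseteq> perms m"
begin

abbreviation (input) rest where "rest \<equiv> window_arcs m C - set (reset_arcs m)"

text \<open>
  One rotation arc at each pattern survives: it is merged, or else it is a permutation whose ends are
  adjacent values, and neither kind is separated.
\<close>

lemma linked_rotate1: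
  assumes "\<sigma> \<in> perms m"
  shows "linked rest \<sigma> (rotate1 \<sigma>)"
proof -
  have ne: "\<sigma> \<noteq> []" using perms_nonempty assms m by fastforce
  have hd: "hd \<sigma> \<in> {1..Suc m}" using hd_in_set[OF ne] assms by (auto simp: perms_iff)
  have m0: "0 < m" using m by simp
  show ?thesis
  proof (cases "\<sigma> \<in> C")
    case True
    have "merged \<sigma> \<notin> perms (Suc m)" using ne by (cases \<sigma>) (auto simp: merged_def perms_iff)
    then have "merged \<sigma> \<in> rest" using True reset_arcs_perms[OF m] by (auto simp: window_arcs_def)
    moreover have "rotate1 \<sigma> \<in> perms m" using assms by (simp add: perms_iff)
    ultimately show ?thesis
      using ne assms by (intro linked_arc[of "merged \<sigma>"]) (simp_all add: tl_merged std_perms, simp add: merged_def std_perms)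
  next
    case False
    have "append_rank \<sigma> (hd \<sigma>) \<notin> set (reset_arcs m)"
      using reset_arcs_separated[OF m] separated_not_covered assms covers_merged_append_rank[OF assms m0 hd] by blast
    moreover have "append_rank \<sigma> (hd \<sigma>) \<in> window_arcs m C"
      using append_rank_perms[OF assms hd] covers_merged_imp_tail[of _ m "append_rank \<sigma> (hd \<sigma>)"]
        std_butlast_append_rank[OF assms] False C by (fastforce simp: window_arcs_def)
    ultimately show ?thesis
      using std_butlast_append_rank[OF assms] std_tl_append_rank_hd[OF assms m0] by (intro linked_arc) auto
  qed
qed

lemma linked_rotate: "\<sigma> \<in> perms m \<Longrightarrow> linked rest \<sigma> (rotate k \<sigma>)"
proof (induction k)
  case (Suc k)
  then have "rotate k \<sigma> \<in> perms m" by (simp add: perms_iff)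
  from linked_trans[OF Suc.IH[OF Suc.prems] linked_rotate1[OF this]] show ?case by simp
qed (simp add: linked_refl)

lemma map_transpose_perms:
  assumes "\<sigma> \<in> perms m" and "a \<in> {1..m}" and "b \<in> {1..m}"
  shows "map (transpose a b) \<sigma> \<in> perms m"
proof -
  have "transpose a b permutes {1..m}" using assms by (intro permutes_swap_id)
  then show ?thesis
    using assms(1) permutes_image[of _ "{1..m}"] by (auto simp: perms_iff distinct_map permutes_inj_on)
qed

lemma linked_swap_hd:
  assumes "\<sigma> \<in> perms m" and "hd \<sigma> = a" and "a < m" and "\<sigma> \<noteq> [1..<Suc m]"
  shows "linked rest \<sigma> (map (transpose a (Suc a)) \<sigma>)"
proof -
  let ?e = "append_rank \<sigma> (a + 2)" and ?\<tau> = "map (transpose a (Suc a)) \<sigma>"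
  have m0: "0 < m" using m by simp
  have ne: "\<sigma> \<noteq> []" using perms_nonempty assms m by fastforce
  have len: "length \<sigma> = m" using length_perms assms(1) .
  have hd: "a \<in> {1..m}" using hd_in_set[OF ne] assms by (auto simp: perms_iff)
  have e: "?e \<in> perms (Suc m)" using append_rank_perms[OF assms(1), of "a + 2"] assms(3) by simp
  have "Suc a \<in> set \<sigma>" using assms(1,3) by (auto simp: perms_iff)
  then obtain c where c: "c < m" "\<sigma> ! c = Suc a" using len by (auto simp: in_set_conv_nth)
  have a0: "\<sigma> ! 0 = a" using assms(2) ne by (simp add: hd_conv_nth)
  have "c \<noteq> 0"
  proof
    assume "c = 0"
    then show False using c(2) a0 by simp
  qed
  then have "separated m ?e"
    unfolding separated_def using c len a0 m0 \<open>c \<noteq> 0\<close>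
    by (intro exI[of _ c]) (auto simp: append_rank_def nth_append)
  then have "?e \<in> window_arcs m C"
    using e separated_not_covered C by (auto simp: window_arcs_def)
  then have "?e \<in> rest" using append_rank_swap_not_reset[OF m assms(1,2,4)] by blast
  then have "linked rest \<sigma> (rotate1 ?\<tau>)"
    using std_butlast_append_rank[OF assms(1)] std_tl_append_rank_swap[OF assms(1,2) m0 assms(3)] by (rule linked_arc)
  moreover have "linked rest ?\<tau> (rotate1 ?\<tau>)"
    using hd assms(3) by (intro linked_rotate1 map_transpose_perms assms(1)) auto
  ultimately show ?thesis using linked_sym linked_trans by blast
qed

text \<open>
  After rotating \<open>a\<close> to the front, the exchange is a single arc, except when the rotated
  pattern is increasing. In that case \<open>a = 1\<close>, and the exchange is performed in the opposite direction,
  starting from the exchanged pattern \<open>2 1 3 \<dots> m\<close> rotated to \<open>1 3 \<dots> m 2\<close>.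
\<close>

lemma linked_swap:
  assumes "\<sigma> \<in> perms m" and "1 \<le> a" and "a < m"
  shows "linked rest \<sigma> (map (transpose a (Suc a)) \<sigma>)"
proof -
  let ?s = "transpose a (Suc a)"
  have s: "map ?s \<tau> \<in> perms m" if "\<tau> \<in> perms m" for \<tau>
    using assms that by (intro map_transpose_perms) auto
  have len: "length \<sigma> = m" using length_perms assms(1) .
  have "a \<in> set \<sigma>" using assms by (auto simp: perms_iff)
  then obtain k where k: "k < m" "\<sigma> ! k = a" using len by (auto simp: in_set_conv_nth)
  let ?\<rho> = "rotate k \<sigma>"
  have \<rho>: "?\<rho> \<in> perms m" using assms(1) by (simp add: perms_iff)
  have hd: "hd ?\<rho> = a" using hd_rotate_conv_nth[of \<sigma> k] k len by fastforce
  have "linked rest ?\<rho> (map ?s ?\<rho>)"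
  proof (cases "?\<rho> = [1..<Suc m]")
    case False
    then show ?thesis using linked_swap_hd[OF \<rho> hd assms(3)] by blast
  next
    case True
    have "[1..<Suc m] = 1 # 2 # 3 # [4..<Suc m]" using m by (simp add: upt_conv_Cons numeral_eq_Suc)
    with True have \<rho>_eq: "?\<rho> = 1 # 2 # 3 # [4..<Suc m]" by simp
    then have "a = 1" using hd by simp
    let ?\<mu> = "rotate1 (map ?s ?\<rho>)"
    have "?\<mu> = 1 # 3 # (map ?s [4..<Suc m] @ [2])"
      unfolding \<rho>_eq \<open>a = 1\<close> by (simp add: transpose_def)
    then have "hd ?\<mu> = a" "?\<mu> \<noteq> [1..<Suc m]" using \<open>a = 1\<close> \<rho>_eq True by auto
    moreover have "?\<mu> \<in> perms m" using s[OF \<rho>] by (simp add: perms_iff)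
    ultimately have "linked rest ?\<mu> (map ?s ?\<mu>)" using linked_swap_hd assms(3) by blast
    also have "map ?s ?\<mu> = rotate1 ?\<rho>" by (simp add: rotate1_map[symmetric] comp_def)
    finally have "linked rest ?\<mu> (rotate1 ?\<rho>)" .
    then show ?thesis
      using linked_rotate1[OF \<rho>] linked_rotate1[OF s[OF \<rho>]] linked_sym linked_trans by blast
  qed
  then have "linked rest ?\<rho> (rotate k (map ?s \<sigma>))" by (simp add: rotate_map)
  from linked_trans[OF linked_trans[OF linked_rotate[OF assms(1)] this]
      linked_sym[OF linked_rotate[OF s[OF assms(1)]]]]
  show ?thesis .
qed

text \<open>
  Any transposition is a product of exchanges of adjacent values, by conjugation.
\<close>

lemma linked_transpose:
  assumes "1 \<le> a" and "a < b" and "b \<le> m" and "\<sigma> \<in> perms m"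
  shows "linked rest \<sigma> (map (transpose a b) \<sigma>)"
  using assms(2,3,4)
proof (induction b arbitrary: \<sigma>)
  case (Suc b)
  show ?case
  proof (cases "a = b")
    case True
    then show ?thesis using linked_swap[OF Suc.prems(3), of a] assms(1) Suc.prems by simp
  next
    case False
    let ?s = "transpose b (Suc b)"
    have b: "a < b" "b < m" "1 \<le> b" using False Suc.prems assms(1) by auto
    have s: "map ?s \<tau> \<in> perms m" if "\<tau> \<in> perms m" for \<tau>
      using b that by (intro map_transpose_perms) auto
    have t: "map (transpose a b) \<tau> \<in> perms m" if "\<tau> \<in> perms m" for \<tau>
      using b assms(1) that by (intro map_transpose_perms) auto
    have "transpose a (Suc b) = ?s \<circ> transpose a b \<circ> ?s"
      using b by (auto simp: transpose_def fun_eq_iff)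
    then have eq: "map (transpose a (Suc b)) \<sigma> = map ?s (map (transpose a b) (map ?s \<sigma>))" by simp
    have "linked rest \<sigma> (map ?s \<sigma>)" using linked_swap Suc.prems(3) b by blast
    also have "linked rest (map ?s \<sigma>) (map (transpose a b) (map ?s \<sigma>))"
      by (rule Suc.IH) (use s[OF Suc.prems(3)] b in auto)
    also have "linked rest (map (transpose a b) (map ?s \<sigma>)) (map ?s (map (transpose a b) (map ?s \<sigma>)))"
      by (rule linked_swap) (use t[OF s[OF Suc.prems(3)]] b in auto)
    finally show ?thesis unfolding eq .
  qed
qed simp

lemma linked_permutation:
  assumes "f permutes {1..m}"
  shows "map f [1..<Suc m] \<in> perms m \<and> linked rest [1..<Suc m] (map f [1..<Suc m])"
  using assms finite_atLeastAtMost[of 1 m]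
proof (induction rule: permutes_induct)
  case id
  then show ?case using upt_perms linked_refl by (simp del: upt_Suc)
next
  case (swap a b p)
  let ?\<sigma> = "map p [1..<Suc m]"
  have \<sigma>: "?\<sigma> \<in> perms m" "linked rest [1..<Suc m] ?\<sigma>" using swap by auto
  have "linked rest ?\<sigma> (map (transpose a b) ?\<sigma>)"
  proof (cases a b rule: linorder_cases)
    case less
    then show ?thesis using linked_transpose[of a b ?\<sigma>] swap(1,2) \<sigma>(1) by auto
  next
    case equal
    then show ?thesis using linked_refl by simp
  next
    case greater
    then show ?thesis using linked_transpose[of b a ?\<sigma>] swap(1,2) \<sigma>(1) transpose_commute[of a b] by auto
  qed
  moreover have "map (transpose a b) ?\<sigma> \<in> perms m" using map_transpose_perms \<sigma>(1) swap(1,2) by blast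
  ultimately show ?case using \<sigma>(2) linked_trans by (metis map_map)
qed

lemma perms_conv_permutes:
  assumes "\<sigma> \<in> perms m"
  shows "\<exists>f. f permutes {1..m} \<and> \<sigma> = map f [1..<Suc m]"
proof -
  let ?f = "\<lambda>x. if x \<in> {1..m} then \<sigma> ! (x - 1) else x"
  have len: "length \<sigma> = m" using length_perms assms .
  have \<sigma>: "map ?f [1..<Suc m] = \<sigma>" using len by (intro nth_equalityI) (auto simp del: upt_Suc)
  have "?f ` {1..m} = {1..m}"
  proof -
    have "?f ` {1..m} = set (map ?f [1..<Suc m])" by (simp add: atLeastLessThanSuc_atLeastAtMost del: upt_Suc)
    then show ?thesis unfolding \<sigma> using assms by (simp add: perms_iff)
  qed
  then have "bij_betw ?f {1..m} {1..m}"
    by (simp add: bij_betw_def finite_surj_inj)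
  then have "?f permutes {1..m}" by (rule bij_imp_permutes) auto
  then show ?thesis using \<sigma> by metis
qed

lemma linked_perms:
  assumes "\<sigma> \<in> perms m" and "\<tau> \<in> perms m"
  shows "linked rest \<sigma> \<tau>"
  using perms_conv_permutes[OF assms(1)] perms_conv_permutes[OF assms(2)] linked_permutation
    linked_sym linked_trans by metis

lemma fin_digraph_pattern_graph: "fin_digraph (pattern_graph m (window_arcs m C))"
proof
  fix e assume e: "e \<in> arcs (pattern_graph m (window_arcs m C))"
  then have "length (butlast e) = m" "length (tl e) = m" using length_window_arcs[OF C, of e] by auto
  then show "tail (pattern_graph m (window_arcs m C)) e \<in> verts (pattern_graph m (window_arcs m C))"
    "head (pattern_graph m (window_arcs m C)) e \<in> verts (pattern_graph m (window_arcs m C))"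
    using std_in_perms[of "butlast e"] std_in_perms[of "tl e"] e m
      distinct_butlast_window_arcs[OF C, of e] distinct_tl_window_arcs[OF C, of e] by auto
qed (use C in \<open>simp_all add: perms_def\<close>)

lemma connected_rest: "connected (pattern_graph m rest)"
proof -
  let ?G = "pattern_graph m (window_arcs m C)" and ?H = "pattern_graph m rest"
  interpret G: fin_digraph ?G by (rule fin_digraph_pattern_graph)
  have "(\<sigma>, \<tau>) \<in> rtrancl_on (verts ?H) ((arcs_ends ?H)\<^sup>s)"
    if "\<sigma> \<in> perms m" and "linked rest \<sigma> \<tau>" for \<sigma> \<tau>
    using that(2) unfolding linked_def
  proof (induction rule: equivclp_induct)
    case base
    then show ?case using that(1) by simp
  next
    case (step \<rho> \<tau>)
    then obtain e where e: "e \<in> rest"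
      "std (butlast e) = \<rho> \<and> std (tl e) = \<tau> \<or> std (butlast e) = \<tau> \<and> std (tl e) = \<rho>" by blast
    then have "(\<rho>, \<tau>) \<in> (arcs_ends ?H)\<^sup>s" "\<tau> \<in> verts ?H"
      using G.tail_in_verts[of e] G.head_in_verts[of e]
      by (force simp: symcl_def arcs_ends_def arc_to_ends_def)+
    then show ?case using step.IH by (meson rtrancl_on_into_rtrancl_on)
  qed
  moreover have "verts ?H \<noteq> {}" using upt_perms by auto
  ultimately show ?thesis unfolding connected_conv using linked_perms by simp
qed

end

section \<open>Closing the word up\<close>

text \<open>
  \<open>L\<close> starts with a decreasing and ends with an increasing block. The new block \<open>H\<close> is placed above
  all letters of \<open>L\<close>, so its windows with the beginning and with the end of \<open>L\<close> are those of the
  reset trail. Since \<open>H\<close> occurs identically at both ends of \<open>H @ L @ H\<close>, the word \<open>H @ L\<close> can be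
  read cyclically.
\<close>

lemma reset_closes_word:
  fixes L :: "rat list"
  assumes m: "3 \<le> m" and L: "realizes m L es"
    and "std (take m L) = rev [1..<Suc m]" and "std (drop (length es) L) = [1..<Suc m]"
  shows "\<exists>H. length H = m \<and> realizes m (H @ L @ H) (patterns m (fall m) @ es @ patterns m (rise m))"
proof -
  have lenL: "length L = length es + m" using L by (simp add: realizes_def)
  obtain B where B: "\<And>x. x \<in> set L \<Longrightarrow> x < B"
    using exists_between_finite_sets[of "set L" "{}"] by auto
  define H where "H = map (\<lambda>x. B + of_nat x) (high m)"
  have H: "length H = m" using m by (simp add: H_def)
  have Hgt: "x < y" if "x \<in> set L" "y \<in> set H" for x y
    using B[OF that(1)] that(2) by (auto simp: H_def)
  have isoH: "order_iso H (high m)" unfolding H_def by (rule order_iso_map) auto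
  have first: "order_iso (take m L) (rev [1..<Suc m])"
    using order_iso_sym[OF order_iso_std[of "take m L"]] assms(3) by simp
  have last: "order_iso (drop (length es) L) [1..<Suc m]"
    using order_iso_sym[OF order_iso_std[of "drop (length es) L"]] assms(4) by simp
  have "order_iso (H @ take m L) (fall m)"
    unfolding fall_def using isoH first
  proof (rule order_iso_append_greater)
    show "y < x" if "x \<in> set H" "y \<in> set (take m L)" for x y
      using Hgt that by (meson in_set_takeD)
    show "y < x" if "x \<in> set (high m)" "y \<in> set (rev [1..<Suc m])" for x y
      using high_greater[OF that(1)] that(2) by auto
  qed
  then have fall: "realizes m (H @ take m L) (patterns m (fall m))"
    using realizes_cong realizes_patterns[of m "fall m"] m by simp
  have "order_iso (drop (length es) L @ H) (rise m)"
    unfolding rise_def using last isoH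
  proof (rule order_iso_append_less)
    show "x < y" if "x \<in> set (drop (length es) L)" "y \<in> set H" for x y
      using Hgt that by (meson in_set_dropD)
    show "x < y" if "x \<in> set [1..<Suc m]" "y \<in> set (high m)" for x y
      using high_greater[OF that(2)] that(1) by auto
  qed
  then have rise: "realizes m (drop (length es) L @ H) (patterns m (rise m))"
    using realizes_cong realizes_patterns[of m "rise m"] m by simp
  have "realizes m (take (length es) L @ drop (length es) L @ H) (es @ patterns m (rise m))"
    by (rule realizes_append) (use L rise lenL in simp_all)
  then have "realizes m (take m L @ (drop m L @ H)) (es @ patterns m (rise m))"
    using lenL by (simp flip: append_assoc)
  then have "realizes m (H @ take m L @ (drop m L @ H)) (patterns m (fall m) @ es @ patterns m (rise m))"
    by (rule realizes_append[OF fall]) (use lenL in simp)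
  then have "realizes m (H @ L @ H) (patterns m (fall m) @ es @ patterns m (rise m))"
    by (simp flip: append_assoc)
  then show ?thesis using H by blast
qed

text \<open>
  The circuit is listed from the middle of the reset trail on: its falling half, the Eulerian trail
  through all remaining arcs, and its rising half.
\<close>

lemma shortened_ucycle_exists:
  assumes m: "3 \<le> m" and i: "i \<le> fact (m - 1)"
  shows "\<exists>z. shortened_ucycle (Suc m) z \<and> length z = fact (Suc m) - i * m"
proof -
  have m0: "0 < m" using m by simp
  obtain C where C: "C \<subseteq> perms m" "rotate1 ` C = C" "card C = i * m"
    using exists_rotation_closed_set[OF m0 i] by blast
  let ?G = "pattern_graph m (window_arcs m C)" and ?P = "reset_arcs m"
  let ?up = "[1..<Suc m]" and ?down = "rev [1..<Suc m]"
  interpret G: fin_digraph ?G using fin_digraph_pattern_graph[OF m C(1)] .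
  have H: "?G\<lparr>arcs := arcs ?G - set ?P\<rparr> = pattern_graph m (window_arcs m C - set ?P)"
    by (simp add: pattern_graph_def)
  have "\<exists>q. pre_digraph.cas (?G\<lparr>arcs := arcs ?G - set ?P\<rparr>) ?down q ?up \<and> distinct q \<and> set q = arcs ?G - set ?P"
  proof (rule G.euler_trail_avoiding)
    fix \<sigma> assume "\<sigma> \<in> verts ?G"
    then have "\<sigma> \<in> perms m" by simp
    then show "in_degree ?G \<sigma> = out_degree ?G \<sigma>"
      using in_degree_window_arcs[OF C(1) m0 C(2), of \<sigma>] out_degree_window_arcs[OF C(1) m0, of \<sigma>]
      unfolding in_degree_def out_degree_def in_arcs_def out_arcs_def pattern_graph_sel by linarith
  next
    show "G.trail ?up ?P ?down" using reset_trail[OF m C(1)] .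
    have "?up ! 0 \<noteq> ?down ! 0" using m by (simp add: rev_nth del: upt_Suc)
    then show "?up \<noteq> ?down" by metis
    show "connected (?G\<lparr>arcs := arcs ?G - set ?P\<rparr>)"
      unfolding H using connected_rest[OF m C(1)] .
  qed
  then obtain es where es: "pre_digraph.cas (pattern_graph m (window_arcs m C - set ?P)) ?down es ?up"
    "distinct es" "set es = window_arcs m C - set ?P"
    unfolding H by auto
  have "\<exists>L::rat list. realizes m L es \<and> std (take m L) = ?down \<and> std (drop (length es) L) = ?up"
    using es(1) by (rule cas_imp_realizes) (use es(3) length_window_arcs[OF C(1)] upt_perms in auto)
  then obtain L :: "rat list" where L: "realizes m L es" "std (take m L) = ?down" "std (drop (length es) L) = ?up"
    by blast
  obtain H where H: "length H = m"
    and W: "realizes m (H @ L @ H) (patterns m (fall m) @ es @ patterns m (rise m))"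
    using reset_closes_word[OF m L] by blast
  define fs where "fs = patterns m (fall m) @ es @ patterns m (rise m)"
  define Z where "Z = H @ L"
  have set_fs: "set fs = window_arcs m C"
    using reset_arcs_window_arcs[OF m C(1)] es(3) by (auto simp: fs_def reset_arcs_def)
  have "distinct fs"
    using distinct_reset_arcs[OF m] es(2,3) by (auto simp: fs_def reset_arcs_def)
  have len: "length Z = length fs"
    using H L(1) m by (simp add: Z_def fs_def realizes_def)
  have Zne: "Z \<noteq> []" and lm: "m \<le> length Z" using H m by (auto simp: Z_def)
  \<comment> \<open>Standardization turns the rational letters into natural numbers.\<close>
  have "order_iso (cyclic_window (Suc m) (std Z) j) (fs ! j)" if "j < length (std Z)" for j
  proof -
    have j: "j < length Z" using that by simp
    have "cyclic_window (Suc m) Z j = take (Suc m) (drop j (H @ L @ H))"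
      using cyclic_window_conv_take_drop[OF j, of "Suc m"] lm H by (simp add: Z_def)
    then have "order_iso (cyclic_window (Suc m) Z j) (fs ! j)"
      using W j len unfolding realizes_def fs_def[symmetric] by simp
    moreover have "order_iso (cyclic_window (Suc m) (std Z) j) (cyclic_window (Suc m) Z j)"
      using order_iso_cyclic_window[OF order_iso_std] Zne by (metis length_0_conv length_std)
    ultimately show ?thesis using order_iso_trans by blast
  qed
  then have "shortened_ucycle (Suc m) (std Z)"
    using shortened_ucycleI[OF C(1) set_fs \<open>distinct fs\<close>] len by simp
  moreover have "length (std Z) = fact (Suc m) - i * m"
    using len distinct_card[OF \<open>distinct fs\<close>] set_fs card_window_arcs[OF C(1) m0] C(3) by simp
  ultimately show ?thesis by blast
qed

section \<open>Permutations of three letters\<close>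

lemma Ex1_less_Suc:
  "(\<exists>!j. j < Suc n \<and> P j) \<longleftrightarrow> (P n \<and> (\<forall>j<n. \<not> P j)) \<or> (\<not> P n \<and> (\<exists>!j. j < n \<and> P j))"
  by (auto simp: less_Suc_eq)

lemma Ex1_eq_conj: "(\<exists>!x. x = a \<and> P x) \<longleftrightarrow> P a"
  by auto

lemma perms_3:
  "permutations_of_set {1..3::nat} = {[1,2,3], [1,3,2], [2,1,3], [2,3,1], [3,1,2], [3,2,1]}"
proof -
  have "{1..3::nat} = {1, 2, 3}" by auto
  moreover have "{1, 2, 3} - {1} = {2, 3::nat}" "{1, 2, 3} - {2} = {1, 3::nat}" "{1, 2, 3} - {3} = {1, 2::nat}"
    by auto
  ultimately show ?thesis
    by (subst permutations_of_set_nonempty) (auto simp: permutations_of_set_doubleton)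
qed

lemma cyclic_window_3:
  "cyclic_window 3 z j =
    [z ! (j mod length z), z ! (Suc j mod length z), z ! (Suc (Suc j) mod length z)]"
  by (simp add: cyclic_window_def numeral_3_eq_3)

lemma covers_3:
  "covers [a, b, c] [x, y, z] \<longleftrightarrow>
    (a < b \<longrightarrow> x < y) \<and> (a < c \<longrightarrow> x < z) \<and> (b < a \<longrightarrow> y < x) \<and>
    (b < c \<longrightarrow> y < z) \<and> (c < a \<longrightarrow> z < x) \<and> (c < b \<longrightarrow> z < y)"
  by (auto simp: covers_def All_less_Suc)

lemma shortened_ucycle_3I:
  assumes "\<forall>j<length z. cyclic_window 3 z j ! 0 \<noteq> cyclic_window 3 z j ! 1 \<and> cyclic_window 3 z j ! 1 \<noteq> cyclic_window 3 z j ! 2"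
    and "\<forall>p\<in>{[1,2,3], [1,3,2], [2,1,3], [2,3,1], [3,1,2], [3,2,1]}.
      \<exists>!j. j < length z \<and> covers (cyclic_window 3 z j) p"
  shows "shortened_ucycle 3 z"
  unfolding shortened_ucycle_def perms_3
proof (intro conjI assms(2) allI impI)
  fix j a b :: nat
  assume j: "j < length z"
    and ab: "a < b \<and> b < 3 \<and> cyclic_window 3 z j ! a = cyclic_window 3 z j ! b"
  then have "(a = 0 \<and> b = 1) \<or> (a = 0 \<and> b = 2) \<or> (a = 1 \<and> b = 2)" by linarith
  moreover have "\<not> (a = 0 \<and> b = 1)" "\<not> (a = 1 \<and> b = 2)" using assms(1) j ab by blast+
  ultimately have "a = 0 \<and> b = 2" by blast
  then show "a = 0" "b = 3 - 1" by simp_all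
qed

lemma shortened_ucycle_3: "shortened_ucycle 3 [1,4,5,2,4,3]" "shortened_ucycle 3 [1,2,3,2]"
  by (rule shortened_ucycle_3I;
      simp add: cyclic_window_3 Ex1_less_Suc Ex1_eq_conj All_less_Suc covers_3)+

theorem theorem2:
  fixes n i :: nat
  assumes "n \<ge> 3"
    and "i \<le> fact (n - 2)"
  shows "\<exists>z. shortened_ucycle n z \<and> length z = fact n - i * (n - 1)"
proof (cases "n = 3")
  case True
  then consider "i = 0" | "i = 1" using assms(2) by fastforce
  then show ?thesis
  proof cases
    case 1
    then show ?thesis using True shortened_ucycle_3(1)
      by (intro exI[of _ "[1,4,5,2,4,3]"]) (simp add: fact_numeral)
  next
    case 2
    then show ?thesis using True shortened_ucycle_3(2)
      by (intro exI[of _ "[1,2,3,2]"]) (simp add: fact_numeral)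
  qed
next
  case False
  then have "3 \<le> n - 1" "n = Suc (n - 1)" "n - 1 - 1 = n - 2" using assms(1) by auto
  then show ?thesis using shortened_ucycle_exists[of "n - 1" i] assms(2) by metis
qed

end
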